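(* Let $a$ and $b$ be relatively prime positive integers, let $i,j,m,n\in\{0,1\}$ with $(i,j)\neq(0,0)$ and $(m,n)\neq(0,0)$, and let $\tau\in\mathcal{D}$. If $ia+mb$ is odd or $ja+nb$ is odd, then the following identity of meromorphic functions of $z\in\mathbb{C}$ holds: $$ \begin{aligned} & \frac{1}{a}\sum_{\substack{\mu,\nu =0 \\ (\mu,\nu) \neq(0,0)}}^{a-1}(-1)^{i\mu +j\nu } f_{m,n}\left(b\frac{\mu \tau +\nu}{a},\tau \right)f_{ia+mb,\,ja+nb}\left(z+\frac{\mu \tau +\nu}{a},\tau \right) \\ & \quad +\frac{1}{b}\sum_{\substack{\mu,\nu =0 \\ (\mu,\nu) \neq(0,0)}}^{b-1}(-1)^{m\mu +n\nu } f_{i,j}\left(a\frac{\mu \tau +\nu}{b},\tau \right)f_{ia+mb,\,ja+nb}\left(z+\frac{\mu \tau +\nu}{b},\tau \right) \\ & = -f_{i,j}(az,\tau )f_{m,n}(bz,\tau ) +\frac{1}{ab}f_{ia+mb+1,\,1}(z,\tau )f_{1,\,ja+nb+1}(z,\tau ). \end{aligned} $$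
   Context: Let $\mathfrak{H}=\{\tau\in\mathbb{C}\mid \operatorname{Im}\tau>0\}$ and $\mathcal{D}=\{\tau\in\mathfrak{H} \mid |\operatorname{Re}\tau|\le 1,\ |\tau\pm\frac12|\ge\frac12\}$ (the fundamental domain of $\Gamma(2)$ to which $\tau$ is restricted throughout). Write $q^{x}:=e^{2\pi\sqrt{-1}\,x\tau}$ for real $x$. The Jacobi theta functions are $$\theta_1(z,\tau)=2\sum_{n=0}^\infty(-1)^n q^{\frac12(n+\frac12)^2}\sin((2n+1)\pi z),\qquad \theta_2(z,\tau)=2\sum_{n=0}^\infty q^{\frac12(n+\frac12)^2}\cos((2n+1)\pi z),$$ $$\theta_3(z,\tau)=1+2\sum_{n=1}^\infty q^{\frac12 n^2}\cos(2n\pi z),\qquad \theta_4(z,\tau)=1+2\sum_{n=1}^\infty(-1)^n q^{\frac12 n^2}\cos(2n\pi z).$$ Put $k=k(\tau)=\theta_2(0,\tau)^2/\theta_3(0,\tau)^2$ and $K=K(\tau)=\frac{\pi}{2}\theta_3(0,\tau)^2$. The Jacobi elliptic functions are $$\mathrm{sn}(2Kz,k)=\frac{\theta_3(0,\tau)}{\theta_2(0,\tau)}\frac{\theta_1(z,\tau)}{\theta_4(z,\tau)},\quad \mathrm{cn}(2Kz,k)=\frac{\theta_4(0,\tau)}{\theta_2(0,\tau)}\frac{\theta_2(z,\tau)}{\theta_4(z,\tau)},\quad \mathrm{dn}(2Kz,k)=\frac{\theta_4(0,\tau)}{\theta_3(0,\tau)}\frac{\theta_3(z,\tau)}{\theta_4(z,\tau)},$$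 and $\mathrm{cs}=\mathrm{cn}/\mathrm{sn}$, $\mathrm{ds}=\mathrm{dn}/\mathrm{sn}$, $\mathrm{ns}=1/\mathrm{sn}$. Define $$f_{1,0}(z,\tau):=2K\,\mathrm{cs}(2Kz,k),\qquad f_{1,1}(z,\tau):=2K\,\mathrm{ds}(2Kz,k),\qquad f_{0,1}(z,\tau):=2K\,\mathrm{ns}(2Kz,k).$$ The indices of $f$ are regarded as elements of $\mathbb{Z}/2\mathbb{Z}$ (i.e. reduced mod 2); $f_{0,0}$ is not defined. Empty sums (when $a=1$ or $b=1$) are $0$. *)

theory Defs
  imports "HOL-Complex_Analysis.Complex_Analysis"
begin

definition fund_domain_Gamma2 :: "complex set" where
  "fund_domain_Gamma2 =
     {\<tau>. Im \<tau> > 0 \<and> \<bar>Re \<tau>\<bar> \<le> 1 \<and> cmod (\<tau> + 1/2) \<ge> 1/2 \<and> cmod (\<tau> - 1/2) \<ge> 1/2}"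

definition qpow :: "complex \<Rightarrow> real \<Rightarrow> complex" where
  "qpow \<tau> x = exp (2 * of_real pi * \<i> * of_real x * \<tau>)"

(* The nome here is q^(1/2) = exp(pi i tau), and the zeros of theta1 are Z + Z tau. *)

definition theta1 :: "complex \<Rightarrow> complex \<Rightarrow> complex" where
  "theta1 z \<tau> =
     2 * (\<Sum>n. (-1)^n * qpow \<tau> (1/2 * (real n + 1/2)^2) * sin ((2 * of_nat n + 1) * of_real pi * z))"

definition theta2 :: "complex \<Rightarrow> complex \<Rightarrow> complex" where
  "theta2 z \<tau> =
     2 * (\<Sum>n. qpow \<tau> (1/2 * (real n + 1/2)^2) * cos ((2 * of_nat n + 1) * of_real pi * z))"

definition theta3 :: "complex \<Rightarrow> complex \<Rightarrow> complex" where
  "theta3 z \<tau> =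
     1 + 2 * (\<Sum>n. qpow \<tau> (1/2 * (real (Suc n))^2) * cos (2 * of_nat (Suc n) * of_real pi * z))"

definition theta4 :: "complex \<Rightarrow> complex \<Rightarrow> complex" where
  "theta4 z \<tau> =
     1 + 2 * (\<Sum>n. (-1)^(Suc n) * qpow \<tau> (1/2 * (real (Suc n))^2)
                      * cos (2 * of_nat (Suc n) * of_real pi * z))"

definition jacobi_K :: "complex \<Rightarrow> complex" where
  "jacobi_K \<tau> = of_real pi / 2 * theta3 0 \<tau> ^ 2"

(* The elliptic functions are given the parameter tau in place of the modulus
   k = theta2(0,tau)^2 / theta3(0,tau)^2, so that jacobi_sn u tau is sn(u, k(tau));
   the substitution is u = 2 K z. *)

definition jacobi_sn :: "complex \<Rightarrow> complex \<Rightarrow> complex" where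
  "jacobi_sn u \<tau> = (let z = u / (2 * jacobi_K \<tau>) in
     theta3 0 \<tau> / theta2 0 \<tau> * (theta1 z \<tau> / theta4 z \<tau>))"

definition jacobi_cn :: "complex \<Rightarrow> complex \<Rightarrow> complex" where
  "jacobi_cn u \<tau> = (let z = u / (2 * jacobi_K \<tau>) in
     theta4 0 \<tau> / theta2 0 \<tau> * (theta2 z \<tau> / theta4 z \<tau>))"

definition jacobi_dn :: "complex \<Rightarrow> complex \<Rightarrow> complex" where
  "jacobi_dn u \<tau> = (let z = u / (2 * jacobi_K \<tau>) in
     theta4 0 \<tau> / theta3 0 \<tau> * (theta3 z \<tau> / theta4 z \<tau>))"

(* The quotients are quotients of meromorphic functions: at the common poles of sn, cn, dn
   (the zeros of theta4) their singularities are removable, whereas pointwise division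
   would give a wrong value there. remove_sings supplies the correct values, which matter
   because f is also evaluated at torsion points, possibly at zeros of theta4.
   At genuine poles the value is 0 by convention. *)

definition jacobi_cs :: "complex \<Rightarrow> complex \<Rightarrow> complex" where
  "jacobi_cs u \<tau> = remove_sings (\<lambda>w. jacobi_cn w \<tau> / jacobi_sn w \<tau>) u"

definition jacobi_ds :: "complex \<Rightarrow> complex \<Rightarrow> complex" where
  "jacobi_ds u \<tau> = remove_sings (\<lambda>w. jacobi_dn w \<tau> / jacobi_sn w \<tau>) u"

definition jacobi_ns :: "complex \<Rightarrow> complex \<Rightarrow> complex" where
  "jacobi_ns u \<tau> = remove_sings (\<lambda>w. 1 / jacobi_sn w \<tau>) u"

(* The indices only matter modulo 2; there is no function with both indices even. *)

definition ell_f :: "nat \<Rightarrow> nat \<Rightarrow> complex \<Rightarrow> complex \<Rightarrow> complex" where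
  "ell_f r s z \<tau> =
     (if odd r \<and> even s then 2 * jacobi_K \<tau> * jacobi_cs (2 * jacobi_K \<tau> * z) \<tau>
      else if odd r \<and> odd s then 2 * jacobi_K \<tau> * jacobi_ds (2 * jacobi_K \<tau> * z) \<tau>
      else if even r \<and> odd s then 2 * jacobi_K \<tau> * jacobi_ns (2 * jacobi_K \<tau> * z) \<tau>
      else undefined)"

(* Equality as meromorphic functions on the plane: both sides are meromorphic and they
   agree off a closed discrete set (where either side may have poles). *)

definition meromorphic_eq :: "(complex \<Rightarrow> complex) \<Rightarrow> (complex \<Rightarrow> complex) \<Rightarrow> bool" where
  "meromorphic_eq F G \<longleftrightarrow>
     F meromorphic_on UNIV \<and> G meromorphic_on UNIV \<and> (\<forall>\<^sub>\<approx>z\<in>UNIV. F z = G z)"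

end

theory Submission
  imports Defs
begin

text \<open>
  Pointwise, each of the three functions $f_{r,s}$ is a constant multiple of a quotient
  $\theta_k(z)/\theta_1(z)$. It is odd, has multipliers $(-1)^s$ and $(-1)^r$ under
  $z \mapsto z+1$ and $z \mapsto z+\tau$, and has only simple poles, at the lattice points.
  Its residue $c$ at $0$ is the same for all three indices; the identity is homogeneous of degree 2
  in $f$, so the value $c = 1$ (Jacobi's derivative formula) is never needed.

  Both sides of the identity have multipliers $(-1)^{ja+nb}$ and $(-1)^{ia+mb}$. At a lattice point
  the double poles on the right-hand side cancel, and by oddness there is no residue. At any other
  point of $\frac1a\Lambda$ or $\frac1b\Lambda$ exactly one term of the torsion sums is singular,
  and its residue matches that of $f_{i,j}(az) f_{m,n}(bz)$. So the difference of the
  sides extends to a bounded entire function, hence is constant, and the parity hypothesis makes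
  one multiplier $-1$, which forces the constant to be $0$.

  That $\theta_1$ has only the lattice points as zeros, all simple, follows by comparing it, again
  through Liouville's theorem, with the product side of the triple product identity.
\<close>

subsection \<open>Theta functions and half-period shifts\<close>

text \<open>For each \<open>w\<close> the factor from one term to the next tends to 0, so the radius
  of convergence is infinite. A recurrence in place of a quotient also admits vanishing
  coefficients.\<close>

lemma summable_powser_ratio:
  fixes c r :: "nat \<Rightarrow> complex"
  assumes "\<And>n. c (Suc n) = r n * c n" and "r \<longlonglongrightarrow> 0"
  shows "summable (\<lambda>n. c n * w ^ n)"
proof -
  have "(\<lambda>n. norm (r n * w)) \<longlonglongrightarrow> 0"
    using tendsto_norm_zero[OF tendsto_mult_left_zero[OF assms(2), of w]] by simp
  hence "eventually (\<lambda>n. norm (r n * w) < 1/2) sequentially"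
    by (rule order_tendstoD) simp
  then obtain N where N: "\<And>n. n \<ge> N \<Longrightarrow> norm (r n * w) < 1/2"
    by (auto simp: eventually_sequentially)
  show ?thesis
  proof (rule summable_ratio_test[of "1/2" N])
    fix n assume "n \<ge> N"
    have "norm (c (Suc n) * w ^ Suc n) = norm (r n * w) * norm (c n * w ^ n)"
      by (simp add: assms(1) norm_mult)
    also have "\<dots> \<le> 1/2 * norm (c n * w ^ n)"
      using N[OF \<open>n \<ge> N\<close>] by (intro mult_right_mono) auto
    finally show "norm (c (Suc n) * w ^ Suc n) \<le> 1/2 * norm (c n * w ^ n)" .
  qed simp
qed

lemma holomorphic_powser_ratio:
  fixes c r :: "nat \<Rightarrow> complex"
  assumes "\<And>n. c (Suc n) = r n * c n" and "r \<longlonglongrightarrow> 0"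
  shows "(\<lambda>w. \<Sum>n. c n * w ^ n) holomorphic_on UNIV"
  using termdiffs_strong_converges_everywhere[of c, OF summable_powser_ratio[OF assms]]
  by (subst holomorphic_on_open) auto

text \<open>This is the half of the bilateral theta series with nonnegative exponents. The full
  series is recovered from this one entire function, taken at \<open>w\<close> and at
  \<open>inverse w\<close>.\<close>

definition half_theta :: "complex \<Rightarrow> complex \<Rightarrow> complex" where
  "half_theta p w = (\<Sum>n. p ^ (n ^ 2) * w ^ n)"

lemma half_theta_ratio:
  fixes p :: complex
  assumes "norm p < 1"
  shows "p ^ (Suc n ^ 2) = (p * (p ^ 2) ^ n) * p ^ (n ^ 2)" and "(\<lambda>n. p * (p ^ 2) ^ n) \<longlonglongrightarrow> 0"
proof -
  show "p ^ (Suc n ^ 2) = (p * (p ^ 2) ^ n) * p ^ (n ^ 2)"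
    by (simp add: power2_eq_square power_add power_mult power_mult_distrib algebra_simps)
  have "norm (p ^ 2) < 1"
    using assms by (simp add: norm_power power_less_one_iff)
  thus "(\<lambda>n. p * (p ^ 2) ^ n) \<longlonglongrightarrow> 0"
    by (intro tendsto_mult_right_zero LIMSEQ_power_zero)
qed

lemma summable_half_theta:
  "norm p < 1 \<Longrightarrow> summable (\<lambda>n. p ^ (n ^ 2) * w ^ n :: complex)"
  using summable_powser_ratio[OF half_theta_ratio] by blast

lemma holomorphic_half_theta: "norm p < 1 \<Longrightarrow> half_theta p holomorphic_on UNIV"
  unfolding half_theta_def using holomorphic_powser_ratio[OF half_theta_ratio] by blast

lemma half_theta_tail:
  assumes "norm p < 1"
  shows "half_theta p w = 1 + (\<Sum>n. p ^ (Suc n ^ 2) * w ^ Suc n)"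
  using suminf_split_head[OF summable_half_theta[OF assms, of w]] by (simp add: half_theta_def)

text \<open>Since (n+1)^2 = n^2 + 2n + 1, every term after the first is \<open>p * w\<close> times a
  term of the series at \<open>p ^ 2 * w\<close>. The quasi-periodicity of the theta functions under
  \<open>\<tau>\<close> comes from this.\<close>

lemma half_theta_shift:
  assumes "norm p < 1"
  shows "half_theta p w = 1 + p * w * half_theta p (p ^ 2 * w)"
proof -
  have "p ^ (Suc n ^ 2) * w ^ Suc n = p * w * (p ^ (n ^ 2) * (p ^ 2 * w) ^ n)" for n
    by (subst half_theta_ratio(1)[OF assms]) (simp add: power_mult_distrib)
  hence "(\<Sum>n. p ^ (Suc n ^ 2) * w ^ Suc n) = (\<Sum>n. p * w * (p ^ (n ^ 2) * (p ^ 2 * w) ^ n))"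
    by (rule suminf_cong)
  also have "\<dots> = p * w * half_theta p (p ^ 2 * w)"
    unfolding half_theta_def by (rule suminf_mult[OF summable_half_theta[OF assms]])
  finally show ?thesis
    by (simp only: half_theta_tail[OF assms, of w])
qed

text \<open>Euler's power series for the product of the factors $1 - x^k w$ over $k \ge 0$.\<close>

definition euler_coeff :: "complex \<Rightarrow> nat \<Rightarrow> complex" where
  "euler_coeff x n = (\<Prod>k<n. - (x ^ k) / (1 - x ^ Suc k))"

definition euler_fun :: "complex \<Rightarrow> complex \<Rightarrow> complex" where
  "euler_fun x w = (\<Sum>n. euler_coeff x n * w ^ n)"

lemma euler_coeff_ratio:
  assumes "norm x < 1"
  shows "euler_coeff x (Suc n) = (- (x ^ n) / (1 - x ^ Suc n)) * euler_coeff x n"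
    and "(\<lambda>n. - (x ^ n) / (1 - x ^ Suc n)) \<longlonglongrightarrow> 0"
proof -
  show "euler_coeff x (Suc n) = (- (x ^ n) / (1 - x ^ Suc n)) * euler_coeff x n"
    by (simp add: euler_coeff_def)
  have l: "(\<lambda>n. x ^ n) \<longlonglongrightarrow> 0"
    by (rule LIMSEQ_power_zero) (rule assms)
  have "(\<lambda>n. - (x ^ n) / (1 - x ^ Suc n)) \<longlonglongrightarrow> - 0 / (1 - 0)"
    by (intro tendsto_intros l LIMSEQ_Suc[OF l]) simp
  thus "(\<lambda>n. - (x ^ n) / (1 - x ^ Suc n)) \<longlonglongrightarrow> 0"
    by simp
qed

lemma summable_euler: "norm x < 1 \<Longrightarrow> summable (\<lambda>n. euler_coeff x n * w ^ n)"
  using summable_powser_ratio[OF euler_coeff_ratio] by blast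

lemma holomorphic_euler_fun: "norm x < 1 \<Longrightarrow> euler_fun x holomorphic_on UNIV"
  unfolding euler_fun_def using holomorphic_powser_ratio[OF euler_coeff_ratio] by blast

lemma euler_fun_0: "euler_fun x 0 = 1"
  using powser_sums_zero[of "euler_coeff x", THEN sums_unique]
  by (simp add: euler_fun_def euler_coeff_def)

text \<open>Compare coefficients: c_(n+1) (1 - x^(n+1)) = - x^n c_n. This functional equation splits
  off the first factor of the infinite product and stands in for the product itself.\<close>

lemma euler_fun_shift:
  assumes x: "norm x < 1"
  shows "euler_fun x w = (1 - w) * euler_fun x (x * w)"
proof -
  let ?c = "euler_coeff x"
  have nz: "1 - x ^ Suc n \<noteq> 0" for n
  proof
    assume "1 - x ^ Suc n = 0"
    hence "norm (x ^ Suc n) = 1" by simp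
    moreover have "norm (x ^ Suc n) < 1"
      using x by (simp add: norm_power power_less_one_iff del: power_Suc)
    ultimately show False by simp
  qed
  have rec: "?c (Suc n) * w ^ Suc n = ?c (Suc n) * (x * w) ^ Suc n - w * (?c n * (x * w) ^ n)" for n
  proof -
    have "?c (Suc n) * (1 - x ^ Suc n) = - (x ^ n) * ?c n"
      using nz[of n] by (simp only: euler_coeff_ratio(1)[OF x]) simp
    hence "?c (Suc n) = ?c (Suc n) * x ^ Suc n - ?c n * x ^ n"
      by (simp add: right_diff_distrib diff_eq_eq mult.commute)
    hence "?c (Suc n) * w ^ Suc n = (?c (Suc n) * x ^ Suc n - ?c n * x ^ n) * w ^ Suc n"
      by (rule arg_cong)
    also have "\<dots> = ?c (Suc n) * (x * w) ^ Suc n - w * (?c n * (x * w) ^ n)"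
      by (simp add: power_mult_distrib algebra_simps)
    finally show ?thesis .
  qed
  note sw = summable_euler[OF x, of w] and sx = summable_euler[OF x, of "x * w"]
  have "euler_fun x w = ?c 0 + (\<Sum>n. ?c (Suc n) * w ^ Suc n)"
    using suminf_split_head[OF sw] by (simp add: euler_fun_def)
  also have "(\<Sum>n. ?c (Suc n) * w ^ Suc n) = (\<Sum>n. ?c (Suc n) * (x * w) ^ Suc n - w * (?c n * (x * w) ^ n))"
    by (rule suminf_cong) (rule rec)
  also have "\<dots> = (\<Sum>n. ?c (Suc n) * (x * w) ^ Suc n) - (\<Sum>n. w * (?c n * (x * w) ^ n))"
    by (intro suminf_diff[symmetric] summable_mult sx iffD2[OF summable_Suc_iff[of "\<lambda>n. ?c n * (x * w) ^ n"]])
  also have "(\<Sum>n. w * (?c n * (x * w) ^ n)) = w * euler_fun x (x * w)"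
    unfolding euler_fun_def by (rule suminf_mult[OF sx])
  also have "(\<Sum>n. ?c (Suc n) * (x * w) ^ Suc n) = euler_fun x (x * w) - ?c 0"
    using suminf_split_head[OF sx] by (simp only: euler_fun_def) simp
  finally show ?thesis by (simp add: algebra_simps)
qed

text \<open>If no factor 1 - x^n w vanishes, the functional equation carries a zero at
  \<open>w\<close> to all the points \<open>x ^ n * w\<close>. These tend to 0, where the function
  is continuous with value 1.\<close>

lemma euler_fun_zeroD:
  assumes x: "norm x < 1" and "euler_fun x w = 0"
  shows "\<exists>n. x ^ n * w = 1"
proof (rule ccontr)
  assume *: "\<not> ?thesis"
  have z: "euler_fun x (x ^ n * w) = 0" for n
  proof (induction n)
    case (Suc n)
    thus ?case using * euler_fun_shift[OF x, of "x ^ n * w"] by (auto simp: mult.assoc)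
  qed (use assms in auto)
  have "(\<lambda>n. x ^ n * w) \<longlonglongrightarrow> 0"
    by (intro tendsto_mult_left_zero LIMSEQ_power_zero x)
  moreover have "isCont (euler_fun x) 0"
    using holomorphic_on_imp_continuous_on[OF holomorphic_euler_fun[OF x]]
    by (simp add: continuous_on_eq_continuous_at)
  ultimately have "(\<lambda>n. euler_fun x (x ^ n * w)) \<longlonglongrightarrow> euler_fun x 0"
    by (rule isCont_tendsto_compose[rotated])
  thus False
    by (simp add: z euler_fun_0 LIMSEQ_const_iff)
qed

section \<open>The nome q^(1/2), the phase e^(2 pi i z), and the theta series in these
  variables\<close>

definition nome :: "complex \<Rightarrow> complex" where
  "nome \<tau> = exp (of_real pi * \<i> * \<tau>)"

definition ephase :: "complex \<Rightarrow> complex" where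
  "ephase z = exp (2 * of_real pi * \<i> * z)"

lemma nome_nonzero [simp]: "nome \<tau> \<noteq> 0"
  by (simp add: nome_def)

lemma norm_nome_less_1: "Im \<tau> > 0 \<Longrightarrow> norm (nome \<tau>) < 1"
  by (simp add: nome_def)

lemma nome_power: "nome \<tau> ^ n = exp (of_nat n * of_real pi * \<i> * \<tau>)"
  by (simp add: nome_def exp_of_nat_mult[symmetric] mult_ac)

lemma ephase_nonzero [simp]: "ephase z \<noteq> 0"
  by (simp add: ephase_def)

lemma ephase_0 [simp]: "ephase 0 = 1"
  by (simp add: ephase_def)

lemma ephase_add: "ephase (z + w) = ephase z * ephase w"
  by (simp add: ephase_def ring_distribs exp_add)

lemma ephase_minus: "ephase (- z) = inverse (ephase z)"
  by (simp add: ephase_def exp_minus)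

lemma ephase_1 [simp]: "ephase 1 = 1"
  using exp_two_pi_i by (simp add: ephase_def mult_ac)

lemma ephase_tau: "ephase \<tau> = nome \<tau> ^ 2"
  by (simp add: ephase_def nome_def exp_double[symmetric] mult_ac)

lemma ephase_tau_half: "ephase (\<tau> / 2) = nome \<tau>"
  by (simp add: ephase_def nome_def mult.assoc)

lemma holomorphic_ephase: "ephase holomorphic_on A"
  unfolding ephase_def by (intro holomorphic_intros)

lemma ephase_power: "ephase z ^ n = exp (2 * of_nat n * of_real pi * \<i> * z)"
  by (simp add: ephase_def exp_of_nat_mult[symmetric] mult_ac)

lemma ephase_eq_iff: "ephase z = ephase w \<longleftrightarrow> (\<exists>l::int. z = w + of_int l)"
proof -
  have "2 * of_real pi * \<i> * z = 2 * of_real pi * \<i> * w + of_int (2 * l) * of_real pi * \<i>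
        \<longleftrightarrow> z = w + of_int l" for l :: int
  proof -
    have "2 * of_real pi * \<i> * w + of_int (2 * l) * of_real pi * \<i> = 2 * of_real pi * \<i> * (w + of_int l)"
      by (simp add: algebra_simps)
    thus ?thesis by (simp only: mult_cancel_left) simp
  qed
  thus ?thesis
    unfolding ephase_def exp_eq by simp
qed

lemma two_cos_ephase: "2 * cos (2 * of_nat n * of_real pi * z) = ephase z ^ n + inverse (ephase z) ^ n"
proof -
  have "inverse (ephase z) ^ n = exp (- (\<i> * (2 * of_nat n * of_real pi * z)))"
    by (simp add: power_inverse ephase_power exp_minus mult_ac)
  thus ?thesis
    by (simp add: cos_exp_eq ephase_power mult_ac)
qed

lemma qpow_half_square: "qpow \<tau> (1/2 * (real n) ^ 2) = nome \<tau> ^ (n ^ 2)"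
  by (simp add: qpow_def nome_power mult_ac)

text \<open>The two exponentials of each cosine feed the two halves of the bilateral series. The
  term with exponent 0 lies in both halves, hence the \<open>- 1\<close>.\<close>

lemma theta3_eq_half_theta:
  assumes "Im \<tau> > 0"
  shows "theta3 z \<tau> = half_theta (nome \<tau>) (ephase z) + half_theta (nome \<tau>) (inverse (ephase z)) - 1"
proof -
  let ?p = "nome \<tau>" and ?w = "ephase z"
  note n = norm_nome_less_1[OF assms]
  have s: "summable (\<lambda>n. ?p ^ (Suc n ^ 2) * v ^ Suc n)" for v
    using iffD2[OF summable_Suc_iff summable_half_theta[OF n]] .
  have c: "2 * (nome \<tau> ^ (Suc n ^ 2) * cos (2 * of_nat (Suc n) * of_real pi * z))
            = ?p ^ (Suc n ^ 2) * ?w ^ Suc n + ?p ^ (Suc n ^ 2) * inverse ?w ^ Suc n" for n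
    by (simp only: mult.left_commute[of 2] two_cos_ephase distrib_left)
  have c': "nome \<tau> ^ (Suc n ^ 2) * cos (2 * of_nat (Suc n) * of_real pi * z)
            = 1/2 * (?p ^ (Suc n ^ 2) * ?w ^ Suc n + ?p ^ (Suc n ^ 2) * inverse ?w ^ Suc n)" for n
    using c[of n] by (simp only: c[symmetric]) simp
  have "theta3 z \<tau> = 1 + 2 * (\<Sum>n. nome \<tau> ^ (Suc n ^ 2) * cos (2 * of_nat (Suc n) * of_real pi * z))"
    by (simp only: theta3_def qpow_half_square)
  also have "(\<Sum>n. nome \<tau> ^ (Suc n ^ 2) * cos (2 * of_nat (Suc n) * of_real pi * z))
      = (\<Sum>n. 1/2 * (?p ^ (Suc n ^ 2) * ?w ^ Suc n + ?p ^ (Suc n ^ 2) * inverse ?w ^ Suc n))"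
    by (rule suminf_cong) (rule c')
  also have "\<dots> = 1/2 * ((\<Sum>n. ?p ^ (Suc n ^ 2) * ?w ^ Suc n) + (\<Sum>n. ?p ^ (Suc n ^ 2) * inverse ?w ^ Suc n))"
    by (subst suminf_mult[OF summable_add[OF s s]], subst suminf_add[OF s s]) (rule refl)
  finally show ?thesis
    by (simp add: half_theta_tail[OF n] del: power_Suc)
qed

lemma theta4_eq_theta3: "theta4 z \<tau> = theta3 (z + 1/2) \<tau>"
proof -
  have "cos (2 * of_nat (Suc n) * of_real pi * (z + 1/2))
      = (-1) ^ Suc n * cos (2 * of_nat (Suc n) * of_real pi * z)" for n
  proof -
    have "2 * of_nat (Suc n) * of_real pi * (z + 1/2)
        = 2 * of_nat (Suc n) * of_real pi * z + of_real (real (Suc n) * pi)"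
      by (simp add: algebra_simps)
    thus ?thesis
      by (simp only: cos_add cos_of_real sin_of_real sin_npi cos_npi) (simp add: mult.commute)
  qed
  thus ?thesis
    unfolding theta3_def theta4_def by (simp only: mult_ac)
qed

lemma theta1_eq_theta2: "theta1 z \<tau> = theta2 (z - 1/2) \<tau>"
proof -
  have "cos ((2 * of_nat n + 1) * of_real pi * (z - 1/2))
      = (-1) ^ n * sin ((2 * of_nat n + 1) * of_real pi * z)" for n
  proof -
    have "(2 * of_nat n + 1) * of_real pi * (z - 1/2)
        = (2 * of_nat n + 1) * of_real pi * z - (of_real (real n * pi) + of_real pi / 2)"
      by (simp add: algebra_simps add_divide_distrib)
    moreover have "cos (of_real (real n * pi) + of_real pi / 2) = (0::complex)"
      by (simp only: cos_add cos_of_real sin_of_real sin_npi cos_of_real_pi_half) simp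
    moreover have "sin (of_real (real n * pi) + of_real pi / 2) = ((-1) ^ n :: complex)"
      by (simp only: sin_add cos_of_real sin_of_real sin_npi cos_npi cos_of_real_pi_half sin_of_real_pi_half) simp
    ultimately show ?thesis
      by (simp only: cos_diff) simp
  qed
  thus ?thesis
    unfolding theta1_def theta2_def by (simp only: mult_ac)
qed

text \<open>Expand (n+1/2)^2 = n^2 + n + 1/4: the factor \<open>nome \<tau> ^ n\<close> moves the
  argument by \<open>\<tau> / 2\<close>, and the 1/4 goes into the exponential prefactor.\<close>

lemma theta2_eq_theta3:
  assumes "Im \<tau> > 0"
  shows "theta2 z \<tau> = exp (of_real pi * \<i> * (\<tau> / 4 + z)) * theta3 (z + \<tau> / 2) \<tau>"
proof -
  let ?p = "nome \<tau>" and ?w = "ephase z"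
  let ?E = "exp (of_real pi * \<i> * (\<tau> / 4 + z))"
  note n = norm_nome_less_1[OF assms]
  have s: "summable (\<lambda>n. ?p ^ (n ^ 2) * (?p * v) ^ n)" for v
    by (rule summable_half_theta[OF n])
  have c: "qpow \<tau> (1/2 * (real n + 1/2) ^ 2) * cos ((2 * of_nat n + 1) * of_real pi * z)
        = ?E / 2 * (?p ^ (n ^ 2) * (?p * ?w) ^ n + inverse ?w * (?p ^ (n ^ 2) * (?p * inverse ?w) ^ n))" for n
  proof -
    have q: "qpow \<tau> (1/2 * (real n + 1/2) ^ 2) = exp (of_real pi * \<i> * \<tau> / 4) * ?p ^ (n ^ 2) * ?p ^ n"
      unfolding qpow_def nome_power exp_add[symmetric]
      by (rule arg_cong[of _ _ exp]) (simp add: power2_eq_square algebra_simps add_divide_distrib)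
    have E: "?E = exp (of_real pi * \<i> * \<tau> / 4) * exp (of_real pi * \<i> * z)"
      unfolding exp_add[symmetric] by (rule arg_cong[of _ _ exp]) (simp add: algebra_simps)
    have a: "exp (\<i> * ((2 * of_nat n + 1) * of_real pi * z)) = exp (of_real pi * \<i> * z) * ?w ^ n"
      unfolding ephase_power exp_add[symmetric] by (rule arg_cong[of _ _ exp]) (simp add: algebra_simps)
    have b: "exp (- (\<i> * ((2 * of_nat n + 1) * of_real pi * z)))
        = exp (of_real pi * \<i> * z) * inverse ?w * inverse ?w ^ n"
      unfolding ephase_minus[symmetric] ephase_power unfolding ephase_def exp_add[symmetric]
      by (rule arg_cong[of _ _ exp]) (simp add: algebra_simps)
    show ?thesis
      unfolding cos_exp_eq a b q E by (simp add: power_mult_distrib algebra_simps add_divide_distrib)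
  qed
  have "theta2 z \<tau> = 2 * (\<Sum>n. ?E / 2 * (?p ^ (n ^ 2) * (?p * ?w) ^ n + inverse ?w * (?p ^ (n ^ 2) * (?p * inverse ?w) ^ n)))"
    unfolding theta2_def by (simp only: c)
  also have "(\<Sum>n. ?E / 2 * (?p ^ (n ^ 2) * (?p * ?w) ^ n + inverse ?w * (?p ^ (n ^ 2) * (?p * inverse ?w) ^ n)))
      = ?E / 2 * (half_theta ?p (?p * ?w) + inverse ?w * half_theta ?p (?p * inverse ?w))"
    unfolding half_theta_def
    by (subst suminf_mult[OF summable_add[OF s summable_mult[OF s]]],
        subst suminf_add[OF s summable_mult[OF s], symmetric], subst suminf_mult[OF s]) (rule refl)
  \<comment> \<open>The negative half of the half-integer series begins one index later than that of
    \<open>theta3\<close>. The shift equation for \<open>half_theta\<close> repairs this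
    offset.\<close>
  also have "half_theta ?p (?p * inverse ?w) = (half_theta ?p (inverse (?p * ?w)) - 1) * ?w"
  proof -
    have "?p * inverse (?p * ?w) = inverse ?w" "?p ^ 2 * inverse (?p * ?w) = ?p * inverse ?w"
      by (simp_all add: field_simps power2_eq_square)
    hence "half_theta ?p (inverse (?p * ?w)) = 1 + inverse ?w * half_theta ?p (?p * inverse ?w)"
      using half_theta_shift[OF n, of "inverse (?p * ?w)"] by (simp only:)
    thus ?thesis by simp
  qed
  finally show ?thesis
    by (simp add: theta3_eq_half_theta[OF assms] ephase_add ephase_tau_half mult.commute)
qed

lemma theta3_minus: "theta3 (- z) \<tau> = theta3 z \<tau>"
  by (simp add: theta3_def)

lemma theta2_minus: "theta2 (- z) \<tau> = theta2 z \<tau>"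
  by (simp add: theta2_def)

lemma theta4_minus: "theta4 (- z) \<tau> = theta4 z \<tau>"
  by (simp add: theta4_def)

section \<open>Holomorphy and multipliers of the theta functions\<close>

context
  fixes \<tau> :: complex
  assumes Im_pos: "Im \<tau> > 0"
begin

lemma holomorphic_theta3: "(\<lambda>z. theta3 z \<tau>) holomorphic_on UNIV"
proof -
  have "(half_theta (nome \<tau>) \<circ> g) holomorphic_on UNIV" if "g holomorphic_on UNIV" for g
    by (rule holomorphic_on_compose[OF that])
       (rule holomorphic_on_subset[OF holomorphic_half_theta[OF norm_nome_less_1[OF Im_pos]]], simp)
  from this[of ephase] this[of "\<lambda>z. inverse (ephase z)"] show ?thesis
    unfolding theta3_eq_half_theta[OF Im_pos] o_def
    by (intro holomorphic_intros) (simp_all add: holomorphic_ephase holomorphic_on_inverse)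
qed

lemma theta3_plus1: "theta3 (z + 1) \<tau> = theta3 z \<tau>"
  by (simp add: theta3_eq_half_theta[OF Im_pos] ephase_add)

text \<open>Translation by \<open>\<tau>\<close> moves the bilateral series by one index: one half
  loses its leading term and the other gains it, by two instances of
  \<open>half_theta_shift\<close>.\<close>

lemma theta3_plus_tau: "theta3 (z + \<tau>) \<tau> = inverse (nome \<tau> * ephase z) * theta3 z \<tau>"
proof -
  let ?p = "nome \<tau>" and ?w = "ephase z"
  note n = norm_nome_less_1[OF Im_pos]
  have "half_theta ?p ?w = 1 + ?p * ?w * half_theta ?p (?p ^ 2 * ?w)"
    by (rule half_theta_shift[OF n])
  moreover have "half_theta ?p (inverse (?p ^ 2 * ?w))
      = 1 + ?p * inverse (?p ^ 2 * ?w) * half_theta ?p (?p ^ 2 * inverse (?p ^ 2 * ?w))"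
    by (rule half_theta_shift[OF n])
  moreover have "?p * inverse (?p ^ 2 * ?w) = inverse (?p * ?w)" "?p ^ 2 * inverse (?p ^ 2 * ?w) = inverse ?w"
    by (simp_all add: field_simps power2_eq_square)
  moreover have "ephase (z + \<tau>) = ?p ^ 2 * ?w"
    by (simp add: ephase_add ephase_tau[of \<tau>] mult.commute)
  moreover have "inverse (?p * ?w) * (?p * ?w) = 1"
    by (rule left_inverse) simp
  ultimately show ?thesis
    unfolding theta3_eq_half_theta[OF Im_pos] by algebra
qed

text \<open>Otherwise the two halves would add up to 1 everywhere, so \<open>half_theta\<close>
  outside the unit disc would be controlled by its values inside, and Liouville would make it
  constant. This later keeps the factor between \<open>theta1\<close> and its product from being
  0.\<close>

lemma theta3_not_identically_0: "\<exists>z. theta3 z \<tau> \<noteq> 0"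
proof (rule ccontr)
  assume z: "\<not> ?thesis"
  let ?C = "half_theta (nome \<tau>)"
  note n = norm_nome_less_1[OF Im_pos]
  have sum: "?C w + ?C (inverse w) = 1" if "w \<noteq> 0" for w
  proof -
    \<comment> \<open>Every nonzero \<open>w\<close> is a phase, so vanishing for all z becomes an
      equation in \<open>w\<close>.\<close>
    have "ephase (Ln w / (2 * of_real pi * \<i>)) = w"
      using that by (simp add: ephase_def)
    thus ?thesis
      using z theta3_eq_half_theta[OF Im_pos, of "Ln w / (2 * of_real pi * \<i>)"] by simp
  qed
  have "compact (?C ` cball 0 1)"
    by (intro compact_continuous_image holomorphic_on_imp_continuous_on
          holomorphic_on_subset[OF holomorphic_half_theta[OF n]]) auto
  hence "bounded (?C ` cball 0 1)"
    by (rule compact_imp_bounded)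
  then obtain B where "\<forall>x \<in> ?C ` cball 0 1. norm x \<le> B"
    unfolding bounded_iff ..
  hence B: "norm (?C w) \<le> B" if "norm w \<le> 1" for w
    using that by simp
  have "norm (?C w) \<le> 1 + B" for w
  proof (cases "norm w \<le> 1")
    case False
    hence "w \<noteq> 0" by auto
    have "?C w = 1 - ?C (inverse w)" using sum[OF \<open>w \<noteq> 0\<close>] by (simp add: algebra_simps)
    moreover have "norm (inverse w) \<le> 1"
      using False by (simp add: norm_inverse inverse_le_1_iff)
    ultimately show ?thesis
      using B[of "inverse w"] norm_triangle_ineq4[of 1 "?C (inverse w)"] by simp
  next
    case True
    show ?thesis using B[OF True] by simp
  qed
  hence "bounded (range ?C)"
    by (auto simp: bounded_iff)
  hence "?C constant_on UNIV"
    by (rule Liouville_theorem[OF holomorphic_half_theta[OF n]])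
  then obtain c where "\<And>w. ?C w = c"
    by (auto simp: constant_on_def)
  \<comment> \<open>With constant value c, the argument 0 gives c = 1 and the argument 1 gives c = 1
    + p c; together they force the nome p to be 0.\<close>
  thus False
    using half_theta_shift[OF n, of 0] half_theta_shift[OF n, of 1] by simp
qed

lemma theta2_plus1: "theta2 (z + 1) \<tau> = - theta2 z \<tau>"
proof -
  have "exp (of_real pi * \<i> * (\<tau> / 4 + (z + 1))) = - exp (of_real pi * \<i> * (\<tau> / 4 + z))"
    by (simp add: ring_distribs exp_add)
  thus ?thesis
    using theta3_plus1[of "z + \<tau> / 2"] by (simp add: theta2_eq_theta3[OF Im_pos] algebra_simps)
qed

lemma theta2_plus_tau: "theta2 (z + \<tau>) \<tau> = inverse (nome \<tau> * ephase z) * theta2 z \<tau>"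
proof -
  have "exp (of_real pi * \<i> * (\<tau> / 4 + (z + \<tau>))) = nome \<tau> * exp (of_real pi * \<i> * (\<tau> / 4 + z))"
    by (simp add: nome_def exp_add[symmetric] algebra_simps)
  thus ?thesis
    using theta3_plus_tau[of "z + \<tau> / 2"]
    by (simp add: theta2_eq_theta3[OF Im_pos] ephase_add ephase_tau_half algebra_simps)
qed

lemma theta4_plus1: "theta4 (z + 1) \<tau> = theta4 z \<tau>"
  using theta3_plus1[of "z + 1/2"] by (simp add: theta4_eq_theta3 algebra_simps)

lemma ephase_half: "ephase (1/2) = -1"
  by (simp add: ephase_def)

lemma theta4_plus_tau: "theta4 (z + \<tau>) \<tau> = - inverse (nome \<tau> * ephase z) * theta4 z \<tau>"
  using theta3_plus_tau[of "z + 1/2"] by (simp add: theta4_eq_theta3 ephase_add ephase_half algebra_simps)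

lemma theta1_plus1: "theta1 (z + 1) \<tau> = - theta1 z \<tau>"
  using theta2_plus1[of "z - 1/2"] by (simp add: theta1_eq_theta2 algebra_simps)

lemma theta1_plus_tau: "theta1 (z + \<tau>) \<tau> = - inverse (nome \<tau> * ephase z) * theta1 z \<tau>"
  using theta2_plus_tau[of "z - 1/2"] ephase_add[of "z - 1/2" "1/2"]
  by (simp add: theta1_eq_theta2 ephase_half algebra_simps)

lemma theta1_minus: "theta1 (- z) \<tau> = - theta1 z \<tau>"
  using theta2_plus1[of "z - 1/2"] theta2_minus[of "z + 1/2" \<tau>]
  by (simp add: theta1_eq_theta2 add.commute)

lemma holomorphic_theta2: "(\<lambda>z. theta2 z \<tau>) holomorphic_on UNIV"
  unfolding theta2_eq_theta3[OF Im_pos]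
  using holomorphic_on_compose[OF _ holomorphic_on_subset[OF holomorphic_theta3], of "\<lambda>z. z + \<tau> / 2" UNIV]
  by (intro holomorphic_intros) (simp_all add: o_def holomorphic_intros)

lemma holomorphic_theta1: "(\<lambda>z. theta1 z \<tau>) holomorphic_on UNIV"
  unfolding theta1_eq_theta2
  using holomorphic_on_compose[OF _ holomorphic_on_subset[OF holomorphic_theta2], of "\<lambda>z. z - 1/2" UNIV]
  by (simp add: o_def holomorphic_intros)

lemma holomorphic_theta4: "(\<lambda>z. theta4 z \<tau>) holomorphic_on UNIV"
  unfolding theta4_eq_theta3
  using holomorphic_on_compose[OF _ holomorphic_on_subset[OF holomorphic_theta3], of "\<lambda>z. z + 1/2" UNIV]
  by (simp add: o_def holomorphic_intros)

end

subsection \<open>Quasi-periodic meromorphic functions\<close>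

definition period_lattice :: "complex \<Rightarrow> complex set" where
  "period_lattice \<tau> = {of_int k * \<tau> + of_int l | k l. True}"

lemma period_latticeI [intro]: "of_int k * \<tau> + of_int l \<in> period_lattice \<tau>"
  by (auto simp: period_lattice_def)

lemma period_latticeE:
  assumes "z \<in> period_lattice \<tau>"
  obtains k l :: int where "z = of_int k * \<tau> + of_int l"
  using assms by (auto simp: period_lattice_def)

lemma period_lattice_0 [simp]: "0 \<in> period_lattice \<tau>"
  using period_latticeI[of 0 \<tau> 0] by simp

lemma period_lattice_add:
  assumes "z \<in> period_lattice \<tau>" "w \<in> period_lattice \<tau>"
  shows "z + w \<in> period_lattice \<tau>"
proof -
  from assms obtain k l k' l' :: int where "z = of_int k * \<tau> + of_int l" "w = of_int k' * \<tau> + of_int l'"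
    by (auto elim!: period_latticeE)
  thus ?thesis
    using period_latticeI[of "k + k'" \<tau> "l + l'"] by (simp add: algebra_simps)
qed

lemma period_lattice_minus:
  assumes "z \<in> period_lattice \<tau>"
  shows "- z \<in> period_lattice \<tau>"
proof -
  from assms obtain k l :: int where "z = of_int k * \<tau> + of_int l"
    by (rule period_latticeE)
  thus ?thesis
    using period_latticeI[of "- k" \<tau> "- l"] by (simp add: algebra_simps)
qed

lemma period_lattice_minus_iff [simp]: "- z \<in> period_lattice \<tau> \<longleftrightarrow> z \<in> period_lattice \<tau>"
  using period_lattice_minus[of z \<tau>] period_lattice_minus[of "- z" \<tau>] by auto

lemma period_lattice_add_iff:
  assumes "w \<in> period_lattice \<tau>"
  shows "z + w \<in> period_lattice \<tau> \<longleftrightarrow> z \<in> period_lattice \<tau>"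
  using period_lattice_add[OF _ assms, of z]
    period_lattice_add[OF _ period_lattice_minus[OF assms], of "z + w"] by auto

lemma period_lattice_mult:
  assumes "z \<in> period_lattice \<tau>"
  shows "of_int n * z \<in> period_lattice \<tau>"
proof -
  from assms obtain k l :: int where "z = of_int k * \<tau> + of_int l"
    by (rule period_latticeE)
  thus ?thesis
    using period_latticeI[of "n * k" \<tau> "n * l"] by (simp add: algebra_simps)
qed

lemma lattice_coords_unique:
  fixes x y x' y' :: real
  assumes "Im \<tau> > 0" and "of_real x * \<tau> + of_real y = of_real x' * \<tau> + of_real y'"
  shows "x = x'" "y = y'"
proof -
  have "x * Im \<tau> = x' * Im \<tau>"
    using arg_cong[OF assms(2), of Im] by simp
  thus "x = x'" using assms(1) by simp
  thus "y = y'" using assms(2) by simp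
qed

lemma lattice_coords:
  assumes "Im \<tau> > 0"
  obtains x y :: real where "z = of_real x * \<tau> + of_real y"
proof
  show "z = of_real (Im z / Im \<tau>) * \<tau> + of_real (Re z - Im z / Im \<tau> * Re \<tau>)"
    using assms by (simp add: complex_eq_iff)
qed

text \<open>The value type is left general because this is applied to norms and also to predicates,
  such as being a zero or having a finite limit.\<close>

lemma int_shift_invariant:
  fixes f :: "complex \<Rightarrow> 'a"
  assumes "\<And>z. f (z + w) = f z"
  shows "f (z + of_int k * w) = f z"
proof (induction k rule: int_induct[where k = 0])
  case (step1 i)
  thus ?case using assms[of "z + of_int i * w"] by (simp add: algebra_simps)
next
  case (step2 i)
  thus ?case using assms[of "z + of_int (i - 1) * w"] by (simp add: algebra_simps)
qed auto

text \<open>Every value has the norm of a value on the closed fundamental parallelogram, which is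
  compact. Only norms are assumed periodic, so multipliers of modulus 1 are allowed.\<close>

lemma bounded_quasi_periodic:
  assumes "Im \<tau> > 0" and "continuous_on UNIV g"
    and "\<And>z. norm (g (z + 1)) = norm (g z :: complex)" and "\<And>z. norm (g (z + \<tau>)) = norm (g z)"
  shows "bounded (range g)"
proof -
  let ?P = "(\<lambda>(s, t). of_real s * \<tau> + of_real t) ` ({0..1} \<times> {0..1})"
  have "compact ?P"
    by (intro compact_continuous_image compact_Times compact_Icc)
       (auto intro!: continuous_intros simp: case_prod_unfold)
  hence "compact (g ` ?P)"
    by (rule compact_continuous_image[rotated]) (rule continuous_on_subset[OF assms(2)], simp)
  hence "bounded (g ` ?P)"
    by (rule compact_imp_bounded)
  then obtain B where "\<forall>x \<in> g ` ?P. norm x \<le> B"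
    unfolding bounded_iff ..
  hence B: "norm (g z) \<le> B" if "z \<in> ?P" for z
    using that by (rule bspec[OF _ imageI])
  have "norm (g z) \<le> B" for z
  proof -
    obtain x y :: real where z: "z = of_real x * \<tau> + of_real y"
      using lattice_coords[OF assms(1)] by blast
    let ?u = "of_real (frac x) * \<tau> + of_real (frac y) :: complex"
    have "z = ?u + of_int \<lfloor>x\<rfloor> * \<tau> + of_int \<lfloor>y\<rfloor> * 1"
      by (simp add: z frac_def algebra_simps)
    hence "norm (g z) = norm (g ?u)"
      using int_shift_invariant[of "\<lambda>z. norm (g z)" 1 "?u + of_int \<lfloor>x\<rfloor> * \<tau>" "\<lfloor>y\<rfloor>"]
        int_shift_invariant[of "\<lambda>z. norm (g z)" \<tau> ?u "\<lfloor>x\<rfloor>"] assms(3,4) by simp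
    also have "\<dots> \<le> B"
      by (rule B, rule image_eqI[of _ _ "(frac x, frac y)"]) (simp_all add: less_imp_le frac_lt_1)
    finally show ?thesis .
  qed
  thus ?thesis by (auto simp: bounded_iff)
qed

section \<open>Removable singularities and Liouville's theorem for quasi-periodic functions\<close>

text \<open>For a meromorphic function this says that the singularity at \<open>p\<close> is at
  worst removable. It ignores the value at \<open>p\<close>, which may be a default, and it is
  stable under sums and products.\<close>

definition finite_limit :: "(complex \<Rightarrow> complex) \<Rightarrow> complex \<Rightarrow> bool" where
  "finite_limit g p \<longleftrightarrow> (\<exists>L. (g \<longlongrightarrow> L) (at p))"

lemma finite_limitI: "(g \<longlongrightarrow> L) (at p) \<Longrightarrow> finite_limit g p"
  by (auto simp: finite_limit_def)

lemma finite_limit_analytic: "g analytic_on {p} \<Longrightarrow> finite_limit g p"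
  by (meson analytic_at_imp_isCont finite_limitI isContD)

lemma finite_limit_const: "finite_limit (\<lambda>_. c) p"
  by (rule finite_limitI[OF tendsto_const])

lemma finite_limit_add: "finite_limit f p \<Longrightarrow> finite_limit g p \<Longrightarrow> finite_limit (\<lambda>z. f z + g z) p"
  unfolding finite_limit_def using tendsto_add by blast

lemma finite_limit_diff: "finite_limit f p \<Longrightarrow> finite_limit g p \<Longrightarrow> finite_limit (\<lambda>z. f z - g z) p"
  unfolding finite_limit_def using tendsto_diff by blast

lemma finite_limit_mult: "finite_limit f p \<Longrightarrow> finite_limit g p \<Longrightarrow> finite_limit (\<lambda>z. f z * g z) p"
  unfolding finite_limit_def using tendsto_mult by blast

lemma finite_limit_sum:
  "(\<And>x. x \<in> A \<Longrightarrow> finite_limit (f x) p) \<Longrightarrow> finite_limit (\<lambda>z. \<Sum>x\<in>A. f x z) p"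
proof (induction A rule: infinite_finite_induct)
  case (insert x F)
  thus ?case by (simp add: finite_limit_add)
qed (simp_all add: finite_limit_const)

lemma finite_limit_cong:
  assumes "eventually (\<lambda>z. f z = g z) (at p)"
  shows "finite_limit f p \<longleftrightarrow> finite_limit g p"
  unfolding finite_limit_def using tendsto_cong[OF assms] by simp

lemma finite_limit_shift: "finite_limit (\<lambda>z. g (z + w)) p \<longleftrightarrow> finite_limit g (p + w)"
proof
  assume "finite_limit (\<lambda>z. g (z + w)) p"
  then obtain L where "((\<lambda>z. g (z + w)) \<longlongrightarrow> L) (at p)"
    by (auto simp: finite_limit_def)
  from LIM_offset[OF this, of "- w"] show "finite_limit g (p + w)"
    by (auto intro: finite_limitI)
next
  assume "finite_limit g (p + w)"
  then obtain L where "(g \<longlongrightarrow> L) (at (p + w))"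
    by (auto simp: finite_limit_def)
  from LIM_offset[OF this, of w] show "finite_limit (\<lambda>z. g (z + w)) p"
    by (auto intro: finite_limitI)
qed

lemma finite_limit_cmult_iff:
  assumes "e \<noteq> 0"
  shows "finite_limit (\<lambda>z. e * g z) p \<longleftrightarrow> finite_limit g p"
proof
  assume "finite_limit (\<lambda>z. e * g z) p"
  from finite_limit_mult[OF finite_limit_const[of "inverse e"] this] show "finite_limit g p"
    using assms by (simp add: mult.assoc[symmetric])
qed (rule finite_limit_mult[OF finite_limit_const])

text \<open>Translation by a period multiplies \<open>g\<close> by a nonzero constant, so the
  behaviour at 0 decides the behaviour at all lattice points.\<close>

lemma finite_limit_lattice:
  assumes "norm e1 = 1" "norm e2 = 1"
    and "\<And>z. g (z + 1) = e1 * g z" "\<And>z. g (z + \<tau>) = e2 * g z"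
    and "finite_limit g 0" and "p \<in> period_lattice \<tau>"
  shows "finite_limit g p"
proof -
  obtain k l :: int where p: "p = of_int k * \<tau> + of_int l"
    using assms(6) by (rule period_latticeE)
  have s: "finite_limit g (z + w) = finite_limit g z" if "\<And>z. g (z + w) = e * g z" "norm e = 1" for z w e
  proof -
    from that(2) have "e \<noteq> 0" by auto
    thus ?thesis
      using finite_limit_shift[of g w z] finite_limit_cmult_iff[of e g z] that(1) by simp
  qed
  show ?thesis
    using int_shift_invariant[of "finite_limit g" \<tau> 0 k, OF s[OF assms(4,2)]]
      int_shift_invariant[of "finite_limit g" 1 "of_int k * \<tau>" l, OF s[OF assms(3,1)]] assms(5)
    by (simp add: p)
qed

text \<open>Filling in the removable singularities gives an entire function that is bounded by
  quasi-periodicity, hence constant. The conclusion speaks of limits because \<open>g\<close> itself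
  may take other values at singular points.\<close>

lemma liouville_quasi_periodic:
  assumes "Im \<tau> > 0" and mero: "g meromorphic_on UNIV"
    and e: "norm e1 = 1" "norm e2 = 1"
    and per: "\<And>z. g (z + 1) = e1 * g z" "\<And>z. g (z + \<tau>) = e2 * g z"
    and lim: "\<And>p. finite_limit g p"
  obtains c where "\<And>p. (g \<longlongrightarrow> c) (at p)" "e1 * c = c" "e2 * c = c"
proof -
  define G where "G = remove_sings g"
  have G: "(g \<longlongrightarrow> G p) (at p)" for p
    using lim[of p] remove_sings_eqI[of g _ p] unfolding G_def finite_limit_def by metis
  have "\<not> is_pole g p" for p
    using G[of p] not_tendsto_and_filterlim_at_infinity[of "at p" g] unfolding is_pole_def by auto
  hence "G analytic_on UNIV"
    unfolding G_def
    using nicely_meromorphic_without_singularities[OF remove_sings_nicely_meromorphic[OF mero]] mero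
    by (metis UNIV_I is_pole_remove_sings_iff meromorphic_on_isolated_singularity meromorphic_on_subset subset_UNIV)
  hence hol: "G holomorphic_on UNIV"
    by (simp add: analytic_imp_holomorphic)
  \<comment> \<open>The multiplier relation passes from \<open>g\<close> to \<open>G\<close> through
    limits, since the two may differ at individual points.\<close>
  have shift: "G (z + w) = e * G z" if "\<And>z. g (z + w) = e * g z" for z w e
  proof -
    have "((\<lambda>z. g (z + w)) \<longlongrightarrow> G (z + w)) (at z)"
      using LIM_offset[OF G[of "z + w"], of w] by simp
    moreover have "((\<lambda>z. e * g z) \<longlongrightarrow> e * G z) (at z)"
      by (intro tendsto_intros G)
    ultimately show ?thesis
      using that by (simp add: LIM_unique)
  qed
  have "bounded (range G)"
    by (rule bounded_quasi_periodic[OF assms(1) holomorphic_on_imp_continuous_on[OF hol]])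
       (simp_all add: shift[OF per(1)] shift[OF per(2)] norm_mult e)
  then obtain c where c: "\<And>z. G z = c"
    using Liouville_theorem[OF hol] by (auto simp: constant_on_def)
  show ?thesis
    using that[of c] G shift[OF per(1), of 0] shift[OF per(2), of 0] by (simp add: c)
qed

subsection \<open>The torsion-point identity\<close>

text \<open>This is (-1)^n for an integer exponent: lattice coordinates can be negative, while the
  exponents of \<open>(-1) ^ n\<close> are natural numbers.\<close>

definition parity_sign :: "int \<Rightarrow> complex" where
  "parity_sign n = (if even n then 1 else -1)"

lemma parity_sign_add: "parity_sign (m + n) = parity_sign m * parity_sign n"
  by (simp add: parity_sign_def)

lemma parity_sign_eqI: "even (m - n) \<Longrightarrow> parity_sign m = parity_sign n"
  by (simp add: parity_sign_def)

lemma parity_sign_of_nat: "(-1) ^ n = parity_sign (int n)"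
  by (simp add: parity_sign_def)

text \<open>A Bezout combination of \<open>a * p\<close> and \<open>b * p\<close> is
  \<open>p\<close>. Hence, off the lattice, the poles of f(az) and those of f(bz) are
  disjoint.\<close>

lemma lattice_torsion_coprime:
  assumes "coprime a b" and "of_nat a * p \<in> period_lattice \<tau>" and "of_nat b * p \<in> period_lattice \<tau>"
  shows "p \<in> period_lattice \<tau>"
proof -
  have "gcd (int a) (int b) = 1"
    using assms(1) by simp
  then obtain u v where "u * int a + v * int b = 1"
    using bezout_int[of "int a" "int b"] by auto
  from arg_cong[OF this, of "\<lambda>n. of_int n * p"]
  have "p = of_int u * (of_nat a * p) + of_int v * (of_nat b * p)"
    by (simp add: algebra_simps)
  thus ?thesis
    using period_lattice_add[OF period_lattice_mult[OF assms(2)] period_lattice_mult[OF assms(3)], of u v] by simp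
qed

definition torsion_point :: "complex \<Rightarrow> nat \<Rightarrow> nat \<Rightarrow> nat \<Rightarrow> complex" where
  "torsion_point \<tau> a \<mu> \<nu> = (of_nat \<mu> * \<tau> + of_nat \<nu>) / of_nat a"

lemma torsion_point_mult:
  "a > 0 \<Longrightarrow> of_nat a * torsion_point \<tau> a \<mu> \<nu> = of_int (int \<mu>) * \<tau> + of_int (int \<nu>)"
  by (simp add: torsion_point_def)

text \<open>After multiplication by \<open>a\<close>, real coordinates can be compared; they agree
  modulo \<open>a\<close> and lie in the range below \<open>a\<close>. So at most one torsion term
  is singular at a given point.\<close>

lemma torsion_point_diff_lattice:
  assumes "Im \<tau> > 0" "\<mu> < a" "\<nu> < a" "\<mu>' < a" "\<nu>' < a"
    and "torsion_point \<tau> a \<mu> \<nu> - torsion_point \<tau> a \<mu>' \<nu>' \<in> period_lattice \<tau>"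
  shows "\<mu> = \<mu>'" "\<nu> = \<nu>'"
proof -
  from assms(6) obtain k l :: int
    where kl: "torsion_point \<tau> a \<mu> \<nu> - torsion_point \<tau> a \<mu>' \<nu>' = of_int k * \<tau> + of_int l"
    by (rule period_latticeE)
  have a: "a > 0" using assms(2) by simp
  from kl have "of_nat a * torsion_point \<tau> a \<mu> \<nu> = of_nat a * torsion_point \<tau> a \<mu>' \<nu>' + of_nat a * (of_int k * \<tau> + of_int l)"
    by (metis add.commute diff_eq_eq distrib_left)
  hence "of_real (real \<mu>) * \<tau> + of_real (real \<nu>)
      = of_real (real \<mu>' + real a * of_int k) * \<tau> + of_real (real \<nu>' + real a * of_int l)"
    unfolding torsion_point_mult[OF a] by (simp add: algebra_simps)
  note u = lattice_coords_unique[OF assms(1) this]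
  have "int \<mu> = int \<mu>' + int a * k" "int \<nu> = int \<nu>' + int a * l"
    using u by (simp_all flip: of_int_eq_iff[where ?'a = real])
  hence "int \<mu> mod int a = int \<mu>' mod int a" "int \<nu> mod int a = int \<nu>' mod int a"
    by simp_all
  thus "\<mu> = \<mu>'" "\<nu> = \<nu>'"
    using assms(2-5) by simp_all
qed

lemma torsion_point_0 [simp]: "torsion_point \<tau> a 0 0 = 0"
  by (simp add: torsion_point_def)

text \<open>Near $0$, \<open>u z\<close> is \<open>c / z + O(z)\<close>: no constant term.\<close>

definition odd_principal :: "complex \<Rightarrow> (complex \<Rightarrow> complex) \<Rightarrow> bool" where
  "odd_principal c u \<longleftrightarrow> finite_limit (\<lambda>z. (u z - c / z) / z) 0"

lemma odd_principal_scale: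
  assumes "odd_principal c u" and "a \<noteq> 0"
  shows "finite_limit (\<lambda>z. (u (a * z) - c / (a * z)) / (a * z)) 0"
proof -
  obtain L where L: "((\<lambda>z. (u z - c / z) / z) \<longlongrightarrow> L) (at 0)"
    using assms(1) by (auto simp: odd_principal_def finite_limit_def)
  have "filterlim (\<lambda>z. a * z) (at 0) (at (0::complex))"
    unfolding filterlim_at using assms(2) by (auto intro!: tendsto_eq_intros simp: eventually_at_filter)
  from filterlim_compose[OF L this] show ?thesis
    by (rule finite_limitI)
qed

lemma finite_limit_ident: "finite_limit (\<lambda>z. z) p"
  by (rule finite_limitI[OF tendsto_ident_at])

text \<open>This settles the lattice points. Both products have double pole c^2/(a b z^2), which
  cancels. The missing constant terms in the four expansions leave no 1/z term.\<close>

lemma finite_limit_square: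
  assumes "odd_principal c u1" "odd_principal c u2" "odd_principal c u3" "odd_principal c u4"
    and "a \<noteq> 0" "b \<noteq> 0"
  shows "finite_limit (\<lambda>z. u1 (a * z) * u2 (b * z) - 1 / (a * b) * u3 z * u4 z) 0"
proof -
  define e where "e u z = (u z - c / z) / z" for u :: "complex \<Rightarrow> complex" and z
  have u: "u z = c / z + z * e u z" if "z \<noteq> 0" for u z
    using that by (simp add: e_def field_simps)
  note l = odd_principal_scale[OF assms(1,5), folded e_def] odd_principal_scale[OF assms(2,6), folded e_def]
    assms(3,4)[unfolded odd_principal_def, folded e_def]
  \<comment> \<open>Here \<open>A\<close>, \<open>B\<close>, \<open>C\<close>, \<open>D\<close>
    stand for the remainders, which have finite limits. On the right no negative power of z is
    left.\<close>
  have alg: "(c / (a * z) + a * z * A) * (c / (b * z) + b * z * B) - 1 / (a * b) * (c / z + z * C) * (c / z + z * D)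
      = (c * b / a) * B + (c * a / b) * A + a * b * z * z * (A * B)
        - 1 / (a * b) * (c * D + c * C + z * z * (C * D))" if "z \<noteq> 0" for z A B C D
    using that assms(5,6) by (simp add: field_simps)
  have eq: "eventually (\<lambda>z. u1 (a * z) * u2 (b * z) - 1 / (a * b) * u3 z * u4 z
      = (c * b / a) * e u2 (b * z) + (c * a / b) * e u1 (a * z) + a * b * z * z * (e u1 (a * z) * e u2 (b * z))
        - 1 / (a * b) * (c * e u4 z + c * e u3 z + z * z * (e u3 z * e u4 z))) (at 0)"
    unfolding eventually_at_filter
  proof (intro always_eventually allI impI)
    fix z :: complex assume z: "z \<noteq> 0"
    have az: "a * z \<noteq> 0" "b * z \<noteq> 0" using z assms(5,6) by auto
    show "u1 (a * z) * u2 (b * z) - 1 / (a * b) * u3 z * u4 z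
      = (c * b / a) * e u2 (b * z) + (c * a / b) * e u1 (a * z) + a * b * z * z * (e u1 (a * z) * e u2 (b * z))
        - 1 / (a * b) * (c * e u4 z + c * e u3 z + z * z * (e u3 z * e u4 z))"
      unfolding u[OF az(1), of u1] u[OF az(2), of u2] u[OF z, of u3] u[OF z, of u4]
      using alg[OF z, of "e u1 (a * z)" "e u2 (b * z)" "e u3 z" "e u4 z"] .
  qed
  show ?thesis
    unfolding finite_limit_cong[OF eq]
    by (intro finite_limit_add finite_limit_diff finite_limit_mult finite_limit_const finite_limit_ident l)
qed

text \<open>The residues agree: u(az) has residue c/a, so both terms contribute c g(0)/a. What
  remains of \<open>g\<close> is its difference quotient at 0.\<close>

lemma finite_limit_simple_pole:
  assumes "odd_principal c u" "odd_principal c v" and g: "g analytic_on {0}" and "a \<noteq> 0"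
  shows "finite_limit (\<lambda>z. u (a * z) * g z - 1 / a * g 0 * v z) 0"
proof -
  define e where "e u z = (u z - c / z) / z" for u :: "complex \<Rightarrow> complex" and z
  have u: "u z = c / z + z * e u z" if "z \<noteq> 0" for u z
    using that by (simp add: e_def field_simps)
  note l = odd_principal_scale[OF assms(1,4), folded e_def] assms(2)[unfolded odd_principal_def, folded e_def]
  have "(g has_field_derivative deriv g 0) (at 0)"
    using g by (metis analytic_on_imp_differentiable_at DERIV_deriv_iff_field_differentiable singletonI)
  hence d: "finite_limit (\<lambda>z. (g z - g 0) / z) 0"
    unfolding has_field_derivative_iff by (auto intro: finite_limitI)
  have alg: "(c / (a * z) + a * z * A) * G - 1 / a * H * (c / z + z * B)
      = c / a * ((G - H) / z) + a * z * A * G - 1 / a * H * (z * B)" if "z \<noteq> 0" for z A B G H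
    using that assms(4) by (simp add: field_simps)
  have eq: "eventually (\<lambda>z. u (a * z) * g z - 1 / a * g 0 * v z
      = c / a * ((g z - g 0) / z) + a * z * e u (a * z) * g z - 1 / a * g 0 * (z * e v z)) (at 0)"
    unfolding eventually_at_filter
  proof (intro always_eventually allI impI)
    fix z :: complex assume z: "z \<noteq> 0"
    have az: "a * z \<noteq> 0" using z assms(4) by auto
    show "u (a * z) * g z - 1 / a * g 0 * v z
      = c / a * ((g z - g 0) / z) + a * z * e u (a * z) * g z - 1 / a * g 0 * (z * e v z)"
      unfolding u[OF az(1), of u] u[OF z, of v] using alg[OF z, of "e u (a * z)" "g z" "g 0" "e v z"] .
  qed
  show ?thesis
    unfolding finite_limit_cong[OF eq]
    by (intro finite_limit_add finite_limit_diff finite_limit_mult finite_limit_const finite_limit_ident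
        l d finite_limit_analytic[OF g])
qed

section \<open>The identity for any system of odd functions with these multipliers and poles\<close>

text \<open>These are the facts that separate the residue argument from the theta functions. The
  same \<open>c\<close> serves all index pairs, and the oddness and translation laws hold pointwise,
  also at poles. The indices are natural numbers that enter the multipliers through their
  parity.\<close>

locale ell_system =
  fixes \<tau> c :: complex and f :: "nat \<Rightarrow> nat \<Rightarrow> complex \<Rightarrow> complex"
  assumes Im_pos: "Im \<tau> > 0"
    and minus: "odd r \<or> odd s \<Longrightarrow> f r s (- z) = - f r s z"
    and plus_1: "odd r \<or> odd s \<Longrightarrow> f r s (z + 1) = (-1) ^ s * f r s z"
    and plus_tau: "odd r \<or> odd s \<Longrightarrow> f r s (z + \<tau>) = (-1) ^ r * f r s z"
    and analytic: "odd r \<or> odd s \<Longrightarrow> z \<notin> period_lattice \<tau> \<Longrightarrow> f r s analytic_on {z}"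
    and meromorphic: "odd r \<or> odd s \<Longrightarrow> f r s meromorphic_on UNIV"
    and principal: "odd r \<or> odd s \<Longrightarrow> odd_principal c (f r s)"
begin

lemma shift:
  assumes "odd r \<or> odd s"
  shows "f r s (z + (of_int k * \<tau> + of_int l)) = parity_sign (int r * k + int s * l) * f r s z"
proof -
  have 1: "f r s (z + of_int k * \<tau>) = parity_sign (int r * k) * f r s z" for z k
  proof (induction k rule: int_induct[where k = 0])
    case base thus ?case by (simp add: parity_sign_def)
  next
    case (step1 i)
    thus ?case using plus_tau[OF assms, of "z + of_int i * \<tau>"]
      by (simp add: algebra_simps parity_sign_add parity_sign_of_nat)
  next
    case (step2 i)
    thus ?case using plus_tau[OF assms, of "z + of_int (i - 1) * \<tau>"]
      by (auto simp: algebra_simps parity_sign_def split: if_splits)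
  qed
  have 2: "f r s (z + of_int k) = parity_sign (int s * k) * f r s z" for z k
  proof (induction k rule: int_induct[where k = 0])
    case base thus ?case by (simp add: parity_sign_def)
  next
    case (step1 i)
    thus ?case using plus_1[OF assms, of "z + of_int i"]
      by (simp add: algebra_simps parity_sign_add parity_sign_of_nat)
  next
    case (step2 i)
    thus ?case using plus_1[OF assms, of "z + of_int (i - 1)"]
      by (auto simp: algebra_simps parity_sign_def split: if_splits)
  qed
  show ?thesis
    using 1[of z k] 2[of "z + of_int k * \<tau>" l] by (simp add: parity_sign_add add.assoc)
qed

lemma analytic_affine:
  assumes "odd r \<or> odd s" and "x * z + y \<notin> period_lattice \<tau>"
  shows "(\<lambda>z. f r s (x * z + y)) analytic_on {z}"
proof -
  have "(f r s \<circ> (\<lambda>z. x * z + y)) analytic_on {z}"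
    by (rule analytic_on_compose) (use analytic[OF assms] in \<open>auto intro!: analytic_intros\<close>)
  thus ?thesis by (simp add: o_def)
qed

lemma meromorphic_affine:
  assumes "odd r \<or> odd s"
  shows "(\<lambda>z. f r s (x * z + y)) meromorphic_on UNIV"
  by (rule meromorphic_on_compose[OF meromorphic[OF assms]]) (auto intro!: analytic_intros)

text \<open>Exchanging \<open>a\<close>, \<open>i\<close>, \<open>j\<close> with \<open>b\<close>,
  \<open>m\<close>, \<open>n\<close> while keeping \<open>r\<close>, \<open>s\<close> yields the
  other sum of the identity, so each property is proved once for both.\<close>

definition torsion_sum :: "nat \<Rightarrow> nat \<Rightarrow> nat \<Rightarrow> nat \<Rightarrow> nat \<Rightarrow> nat \<Rightarrow> nat \<Rightarrow> nat \<Rightarrow> complex \<Rightarrow> complex" where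
  "torsion_sum r s a b i j m n z =
     (\<Sum>(\<mu>, \<nu>) \<in> {0..<a} \<times> {0..<a} - {(0, 0)}.
        (-1) ^ (i * \<mu> + j * \<nu>) * f m n (of_nat b * torsion_point \<tau> a \<mu> \<nu>) * f r s (z + torsion_point \<tau> a \<mu> \<nu>))"

lemma analytic_term:
  assumes "odd r \<or> odd s" and "p + w \<notin> period_lattice \<tau>"
  shows "finite_limit (\<lambda>z. k * f r s (z + w)) p"
  using analytic_affine[OF assms(1), of 1 p w] assms(2)
  by (intro finite_limit_mult finite_limit_const finite_limit_analytic) simp

text \<open>A term is singular at \<open>p\<close> only if \<open>p\<close> plus a nonzero torsion
  point is a lattice point. Then \<open>a * p\<close> is in the lattice but \<open>p\<close> is
  not.\<close>

lemma finite_limit_torsion_sum: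
  assumes "a > 0" "odd r \<or> odd s" and "p \<in> period_lattice \<tau> \<or> of_nat a * p \<notin> period_lattice \<tau>"
  shows "finite_limit (torsion_sum r s a b i j m n) p"
  unfolding torsion_sum_def case_prod_unfold
proof (intro finite_limit_sum analytic_term assms(2))
  fix x assume x: "x \<in> {0..<a} \<times> {0..<a} - {(0, 0)}"
  let ?w = "torsion_point \<tau> a (fst x) (snd x)"
  show "p + ?w \<notin> period_lattice \<tau>"
  proof (cases "p \<in> period_lattice \<tau>")
    case True
    have "?w \<notin> period_lattice \<tau>"
      using torsion_point_diff_lattice[OF Im_pos, of "fst x" a "snd x" 0 0] x by (cases x) auto
    thus ?thesis
      using period_lattice_add_iff[OF True, of ?w] by (simp add: add.commute)
  next
    case False
    have "of_nat a * (p + ?w) = of_nat a * p + (of_int (int (fst x)) * \<tau> + of_int (int (snd x)))"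
      using torsion_point_mult[OF assms(1)] by (simp add: distrib_left)
    hence "of_nat a * (p + ?w) \<notin> period_lattice \<tau>"
      using False assms(3) period_lattice_add_iff[OF period_latticeI] by metis
    thus ?thesis
      using period_lattice_mult[of "p + ?w" \<tau> "int a"] by auto
  qed
qed

text \<open>Exactly one term of the sum is singular at \<open>p\<close>. By oddness its coefficient
  is, up to sign, f_{m,n}(bp), and its pole cancels that of f_{i,j}(az) f_{m,n}(bz).\<close>

lemma finite_limit_at_torsion:
  assumes "a > 0" "b > 0" "coprime a b" and ij: "odd i \<or> odd j" and mn: "odd m \<or> odd n"
    and r: "r = i * a + m * b" and s: "s = j * a + n * b" and rs: "odd r \<or> odd s"
    and p: "p \<notin> period_lattice \<tau>" "of_nat a * p \<in> period_lattice \<tau>"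
  shows "finite_limit (\<lambda>z. 1 / of_nat a * torsion_sum r s a b i j m n z
           + f i j (of_nat a * z) * f m n (of_nat b * z)) p"
proof -
  obtain X Y :: int where ap: "of_nat a * p = of_int X * \<tau> + of_int Y"
    using p(2) by (rule period_latticeE)
  \<comment> \<open>The singular term belongs to the torsion point congruent to \<open>- p\<close>,
    so its indices are the coordinates of \<open>- a * p\<close> reduced modulo
    \<open>a\<close>.\<close>
  define \<mu> \<nu> where "\<mu> = nat ((- X) mod int a)" and "\<nu> = nat ((- Y) mod int a)"
  have range: "\<mu> < a" "\<nu> < a"
    using assms(1) by (simp_all add: \<mu>_def \<nu>_def nat_less_iff)
  have "int a dvd (int \<mu> + X)" "int a dvd (int \<nu> + Y)"
    using assms(1) by (simp_all add: \<mu>_def \<nu>_def mod_0_imp_dvd mod_add_left_eq flip: mod_eq_0_iff_dvd)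
  then obtain K L where KL: "int \<mu> + X = int a * K" "int \<nu> + Y = int a * L"
    by (auto simp: dvd_def)
  define w where "w = torsion_point \<tau> a \<mu> \<nu>"
  have aw: "of_nat a * w = of_int (int \<mu>) * \<tau> + of_int (int \<nu>)"
    unfolding w_def by (rule torsion_point_mult[OF assms(1)])
  have "of_nat a * (p + w) = of_nat a * (of_int K * \<tau> + of_int L)"
  proof -
    have "of_nat a * (p + w) = of_int (int \<mu> + X) * \<tau> + of_int (int \<nu> + Y)"
      by (simp only: distrib_left ap aw) (simp add: algebra_simps)
    also have "\<dots> = of_nat a * (of_int K * \<tau> + of_int L)"
      unfolding KL by (simp add: algebra_simps)
    finally show ?thesis .
  qed
  hence pw: "p + w = of_int K * \<tau> + of_int L"
    using assms(1) by simp
  define I where "I = {0..<a} \<times> {0..<a} - {(0, 0)}"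
  have in_I: "(\<mu>, \<nu>) \<in> I"
  proof -
    have "(\<mu>, \<nu>) \<noteq> (0, 0)"
    proof
      assume "(\<mu>, \<nu>) = (0, 0)"
      hence "p = of_int K * \<tau> + of_int L"
        using pw by (simp add: w_def)
      thus False using p(1) period_latticeI by blast
    qed
    thus ?thesis using range by (auto simp: I_def)
  qed
  have "finite I" by (simp add: I_def)
  let ?t = "\<lambda>x z. (-1) ^ (i * fst x + j * snd x) * f m n (of_nat b * torsion_point \<tau> a (fst x) (snd x))
                * f r s (z + torsion_point \<tau> a (fst x) (snd x))"
  have split: "torsion_sum r s a b i j m n z = ?t (\<mu>, \<nu>) z + (\<Sum>x \<in> I - {(\<mu>, \<nu>)}. ?t x z)" for z
    unfolding torsion_sum_def case_prod_unfold I_def[symmetric] using sum.remove[OF \<open>finite I\<close> in_I] .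
  have rest: "finite_limit (\<lambda>z. \<Sum>x \<in> I - {(\<mu>, \<nu>)}. ?t x z) p"
  proof (intro finite_limit_sum analytic_term rs)
    fix x assume x: "x \<in> I - {(\<mu>, \<nu>)}"
    show "p + torsion_point \<tau> a (fst x) (snd x) \<notin> period_lattice \<tau>"
    proof
      assume "p + torsion_point \<tau> a (fst x) (snd x) \<in> period_lattice \<tau>"
      from period_lattice_add[OF this period_lattice_minus[OF period_latticeI[of K \<tau> L, folded pw]]]
      have "torsion_point \<tau> a (fst x) (snd x) - torsion_point \<tau> a \<mu> \<nu> \<in> period_lattice \<tau>"
        by (simp add: w_def algebra_simps)
      from torsion_point_diff_lattice[OF Im_pos _ _ range this] x show False
        by (cases x) (auto simp: I_def)
    qed
  qed
  \<comment> \<open>By coprimality the second factor f_{m,n}(bz) is regular at \<open>p\<close>, so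
    the pole of the product is simple.\<close>
  have bp: "of_nat b * p \<notin> period_lattice \<tau>"
    using lattice_torsion_coprime[OF assms(3) p(2)] p(1) by blast
  let ?\<epsilon> = "parity_sign (int i * X + int j * Y)"
  \<comment> \<open>With the origin moved to \<open>p\<close>, the two singular contributions take
    the shape required by \<open>finite_limit_simple_pole\<close>. The term
    \<open>of_nat b * 0\<close> is kept so that its g(0) matches syntactically.\<close>
  have pole: "1 / of_nat a * ?t (\<mu>, \<nu>) (h + p) + f i j (of_nat a * (h + p)) * f m n (of_nat b * (h + p))
      = ?\<epsilon> * (f i j (of_nat a * h) * f m n (of_nat b * h + of_nat b * p)
          - 1 / of_nat a * f m n (of_nat b * 0 + of_nat b * p) * f r s h)" for h
  proof -
    have 1: "f r s (h + p + w) = parity_sign (int r * K + int s * L) * f r s h"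
      using shift[OF rs, of h K L] by (simp add: pw[symmetric] add.assoc)
    \<comment> \<open>Since w is congruent to \<open>- p\<close>, oddness supplies the minus sign
      that makes the residues cancel.\<close>
    have 2: "f m n (of_nat b * w) = - parity_sign (int m * (int b * K) + int n * (int b * L)) * f m n (of_nat b * p)"
    proof -
      have "of_nat b * w = of_nat b * (- p + (of_int K * \<tau> + of_int L))"
        by (simp add: pw[symmetric])
      also have "\<dots> = - (of_nat b * p) + (of_int (int b * K) * \<tau> + of_int (int b * L))"
        by (simp add: algebra_simps)
      finally have "of_nat b * w = - (of_nat b * p) + (of_int (int b * K) * \<tau> + of_int (int b * L))" .
      thus ?thesis
        using shift[OF mn, of "- (of_nat b * p)" "int b * K" "int b * L"] minus[OF mn] by simp
    qed
    have 3: "f i j (of_nat a * (h + p)) = ?\<epsilon> * f i j (of_nat a * h)"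
      using shift[OF ij, of "of_nat a * h" X Y] by (simp add: ap[symmetric] distrib_left)
    \<comment> \<open>Substituting \<open>r = i * a + m * b\<close> and
      \<open>s = j * a + n * b\<close> makes the two exponents differ by an even integer. This is
      where the indices of the third function are forced.\<close>
    have "parity_sign (int (i * \<mu> + j * \<nu>)) * parity_sign (int m * (int b * K) + int n * (int b * L))
        * parity_sign (int r * K + int s * L) = ?\<epsilon>"
    proof -
      have XY: "X = int a * K - int \<mu>" "Y = int a * L - int \<nu>"
        using KL by simp_all
      have eq: "int (i * \<mu> + j * \<nu>) + (int m * (int b * K) + int n * (int b * L)) + (int r * K + int s * L)
          - (int i * X + int j * Y) = 2 * (int i * int \<mu> + int j * int \<nu> + int m * int b * K + int n * int b * L)"
        unfolding r s XY by (simp add: algebra_simps)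
      show ?thesis
        unfolding parity_sign_add[symmetric] by (intro parity_sign_eqI) (simp only: eq dvd_triv_left)
    qed
    hence "?t (\<mu>, \<nu>) (h + p) = - ?\<epsilon> * (f m n (of_nat b * p) * f r s h)"
      using 1 2 by (simp add: w_def[symmetric] parity_sign_of_nat mult_ac)
    thus ?thesis
      using 3 by (simp add: algebra_simps)
  qed
  have "finite_limit (\<lambda>h. ?\<epsilon> * (f i j (of_nat a * h) * f m n (of_nat b * h + of_nat b * p)
          - 1 / of_nat a * f m n (of_nat b * 0 + of_nat b * p) * f r s h)) 0"
    by (intro finite_limit_mult[OF finite_limit_const]
        finite_limit_simple_pole[of c "f i j" "f r s" "\<lambda>h. f m n (of_nat b * h + of_nat b * p)"]
        principal ij rs analytic_affine mn) (use assms(1) bp in auto)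
  hence "finite_limit (\<lambda>z. 1 / of_nat a * ?t (\<mu>, \<nu>) z + f i j (of_nat a * z) * f m n (of_nat b * z)) p"
    unfolding pole[symmetric]
    using finite_limit_shift[of "\<lambda>z. 1 / of_nat a * ?t (\<mu>, \<nu>) z + f i j (of_nat a * z) * f m n (of_nat b * z)" p 0]
    by simp
  from finite_limit_add[OF this finite_limit_mult[OF finite_limit_const[of "1 / of_nat a"] rest]] show ?thesis
    unfolding split by (simp add: algebra_simps)
qed

lemma torsion_sum_plus_1:
  assumes "odd r \<or> odd s"
  shows "torsion_sum r s a b i j m n (z + 1) = (-1) ^ s * torsion_sum r s a b i j m n z"
proof -
  have "f r s (z + 1 + w) = (-1) ^ s * f r s (z + w)" for w
    using plus_1[OF assms, of "z + w"] by (simp add: algebra_simps)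
  thus ?thesis
    unfolding torsion_sum_def sum_distrib_left by (simp add: case_prod_unfold mult_ac)
qed

lemma torsion_sum_plus_tau:
  assumes "odd r \<or> odd s"
  shows "torsion_sum r s a b i j m n (z + \<tau>) = (-1) ^ r * torsion_sum r s a b i j m n z"
proof -
  have "f r s (z + \<tau> + w) = (-1) ^ r * f r s (z + w)" for w
    using plus_tau[OF assms, of "z + w"] by (simp add: algebra_simps)
  thus ?thesis
    unfolding torsion_sum_def sum_distrib_left by (simp add: case_prod_unfold mult_ac)
qed

lemma meromorphic_torsion_sum:
  assumes "odd r \<or> odd s"
  shows "torsion_sum r s a b i j m n meromorphic_on UNIV"
  unfolding torsion_sum_def case_prod_unfold
  using meromorphic_affine[OF assms, of 1] by (intro meromorphic_intros) simp_all

theorem torsion_identity: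
  assumes "a > 0" "b > 0" "coprime a b" and ij: "odd i \<or> odd j" and mn: "odd m \<or> odd n"
    and r: "r = i * a + m * b" and s: "s = j * a + n * b" and rs: "odd r \<or> odd s"
  shows "meromorphic_eq
    (\<lambda>z. 1 / of_nat a * torsion_sum r s a b i j m n z + 1 / of_nat b * torsion_sum r s b a m n i j z)
    (\<lambda>z. - f i j (of_nat a * z) * f m n (of_nat b * z)
         + 1 / (of_nat a * of_nat b) * f (r + 1) 1 z * f 1 (s + 1) z)"
    (is "meromorphic_eq ?lhs ?rhs")
proof -
  define g where "g z = f i j (of_nat a * z) * f m n (of_nat b * z)" for z
  define h where "h z = 1 / (of_nat a * of_nat b) * f (r + 1) 1 z * f 1 (s + 1) z" for z
  define Sa where "Sa z = 1 / of_nat a * torsion_sum r s a b i j m n z" for z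
  define Sb where "Sb z = 1 / of_nat b * torsion_sum r s b a m n i j z" for z
  \<comment> \<open>The grouping pairs \<open>g\<close> with \<open>h\<close>, because their double
    poles cancel at 0. At other torsion points \<open>g\<close> is regrouped with \<open>Sa\<close>
    or with \<open>Sb\<close>.\<close>
  define F where "F z = (Sa z + Sb z) + (g z - h z)" for z
  have odd1: "odd (r + 1) \<or> odd (1::nat)" "odd (1::nat) \<or> odd (s + 1)" by auto
  have mf: "(\<lambda>z. f r s (x * z)) meromorphic_on UNIV" if "odd r \<or> odd s" for r s x
    using meromorphic_affine[OF that, of x 0] by simp
  have mero: "?lhs meromorphic_on UNIV" "?rhs meromorphic_on UNIV"
    using assms(1,2) 
    by (intro meromorphic_intros meromorphic_torsion_sum rs meromorphic odd1 mf ij mn; simp)+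
  have F_eq: "F z = ?lhs z - ?rhs z" for z
    by (simp add: F_def Sa_def Sb_def g_def h_def)
  have F_mero: "F meromorphic_on UNIV"
    unfolding F_eq[abs_def] by (intro meromorphic_on_diff mero)
  have F1: "F (z + 1) = (-1) ^ s * F z" for z
  proof -
    have "f i j (of_nat a * (z + 1)) = parity_sign (int j * int a) * f i j (of_nat a * z)"
      using shift[OF ij, of "of_nat a * z" 0 "int a"] by (simp add: algebra_simps)
    moreover have "f m n (of_nat b * (z + 1)) = parity_sign (int n * int b) * f m n (of_nat b * z)"
      using shift[OF mn, of "of_nat b * z" 0 "int b"] by (simp add: algebra_simps)
    ultimately have "g (z + 1) = (-1) ^ s * g z"
      unfolding g_def s parity_sign_of_nat of_nat_add of_nat_mult parity_sign_add by (simp add: mult_ac)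
    \<comment> \<open>The two factors of \<open>h\<close> contribute the multipliers (-1)^1 and
      (-1)^(s+1), whose product is (-1)^s.\<close>
    moreover have "h (z + 1) = (-1) ^ s * h z"
      unfolding h_def plus_1[OF odd1(1)] plus_1[OF odd1(2)] by simp
    ultimately show ?thesis
      unfolding F_def Sa_def Sb_def torsion_sum_plus_1[OF rs] by (simp add: ring_distribs mult_ac)
  qed
  have F2: "F (z + \<tau>) = (-1) ^ r * F z" for z
  proof -
    have "f i j (of_nat a * (z + \<tau>)) = parity_sign (int i * int a) * f i j (of_nat a * z)"
      using shift[OF ij, of "of_nat a * z" "int a" 0] by (simp add: algebra_simps)
    moreover have "f m n (of_nat b * (z + \<tau>)) = parity_sign (int m * int b) * f m n (of_nat b * z)"
      using shift[OF mn, of "of_nat b * z" "int b" 0] by (simp add: algebra_simps)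
    ultimately have "g (z + \<tau>) = (-1) ^ r * g z"
      unfolding g_def r parity_sign_of_nat of_nat_add of_nat_mult parity_sign_add by (simp add: mult_ac)
    moreover have "h (z + \<tau>) = (-1) ^ r * h z"
      unfolding h_def plus_tau[OF odd1(1)] plus_tau[OF odd1(2)] by simp
    ultimately show ?thesis
      unfolding F_def Sa_def Sb_def torsion_sum_plus_tau[OF rs] by (simp add: ring_distribs mult_ac)
  qed
  have Sa_lim: "finite_limit Sa p" if "p \<in> period_lattice \<tau> \<or> of_nat a * p \<notin> period_lattice \<tau>" for p
    unfolding Sa_def[abs_def]
    by (intro finite_limit_mult finite_limit_const finite_limit_torsion_sum assms rs that)
  have Sb_lim: "finite_limit Sb p" if "p \<in> period_lattice \<tau> \<or> of_nat b * p \<notin> period_lattice \<tau>" for p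
    unfolding Sb_def[abs_def]
    by (intro finite_limit_mult finite_limit_const finite_limit_torsion_sum assms rs that)
  have h_lim: "finite_limit h p" if "p \<notin> period_lattice \<tau>" for p
    unfolding h_def[abs_def]
    by (intro finite_limit_mult finite_limit_const finite_limit_analytic analytic odd1 that)
  have g_lim: "finite_limit g p"
    if "of_nat a * p \<notin> period_lattice \<tau>" "of_nat b * p \<notin> period_lattice \<tau>" for p
    unfolding g_def[abs_def]
    using analytic_affine[OF ij, of "of_nat a" p 0] analytic_affine[OF mn, of "of_nat b" p 0] that
    by (intro finite_limit_mult finite_limit_analytic) simp_all
  have lim0: "finite_limit F 0"
  proof -
    \<comment> \<open>The torsion sums are regular at 0, so only \<open>g\<close> and
      \<open>h\<close> have to be balanced there.\<close>
    have "finite_limit (\<lambda>z. g z - h z) 0"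
      unfolding g_def h_def
      by (intro finite_limit_square[of c] principal ij mn odd1) (use assms(1,2) in auto)
    thus ?thesis
      unfolding F_def[abs_def] by (intro finite_limit_add Sa_lim Sb_lim) simp_all
  qed
  have e: "norm ((-1) ^ s :: complex) = 1" "norm ((-1) ^ r :: complex) = 1"
    by (simp_all add: norm_power)
  have lim: "finite_limit F p" for p
  proof (cases "p \<in> period_lattice \<tau>")
    case True
    show ?thesis
      by (rule finite_limit_lattice[OF e F1 F2 lim0 True])
  next
    case False
    consider "of_nat a * p \<in> period_lattice \<tau>" | "of_nat b * p \<in> period_lattice \<tau>"
      | "of_nat a * p \<notin> period_lattice \<tau>" "of_nat b * p \<notin> period_lattice \<tau>" by blast
    thus ?thesis
    proof cases
      case 1
      hence "of_nat b * p \<notin> period_lattice \<tau>"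
        using lattice_torsion_coprime[OF assms(3)] False by blast
      moreover have "finite_limit (\<lambda>z. Sa z + g z) p"
        using finite_limit_at_torsion[OF assms False 1] by (simp add: Sa_def g_def)
      ultimately have "finite_limit (\<lambda>z. (Sa z + g z) + Sb z - h z) p"
        by (intro finite_limit_add[of "\<lambda>z. Sa z + g z"] finite_limit_diff Sb_lim h_lim False) simp_all
      thus ?thesis by (simp add: F_def[abs_def] algebra_simps)
    next
      case 2
      hence "of_nat a * p \<notin> period_lattice \<tau>"
        using lattice_torsion_coprime[OF assms(3)] False by blast
      moreover have "finite_limit (\<lambda>z. Sb z + g z) p"
        \<comment> \<open>This is the previous case with the roles of \<open>a\<close>,
          \<open>i\<close>, \<open>j\<close> and \<open>b\<close>, \<open>m\<close>,
          \<open>n\<close> exchanged; \<open>r\<close> and \<open>s\<close> are symmetric under the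
          exchange.\<close>
        using finite_limit_at_torsion[OF assms(2,1) _ mn ij _ _ rs False 2] assms(3)
        by (simp add: Sb_def g_def r s add.commute coprime_commute mult.commute)
      ultimately have "finite_limit (\<lambda>z. (Sb z + g z) + Sa z - h z) p"
        by (intro finite_limit_add[of "\<lambda>z. Sb z + g z"] finite_limit_diff Sa_lim h_lim False) simp_all
      thus ?thesis by (simp add: F_def[abs_def] algebra_simps)
    next
      case 3
      thus ?thesis
        unfolding F_def[abs_def]
        by (intro finite_limit_add finite_limit_diff Sa_lim Sb_lim g_lim h_lim False) simp_all
    qed
  qed
  obtain c where c: "\<And>p. (F \<longlongrightarrow> c) (at p)" "(-1) ^ s * c = c" "(-1) ^ r * c = c"
    using liouville_quasi_periodic[OF Im_pos F_mero e F1 F2 lim] by blast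
  \<comment> \<open>One of the multipliers is -1, so c = -c.\<close>
  have "c = 0"
    using c(2,3) rs by auto
  \<comment> \<open>Limits say nothing about the values of \<open>F\<close> at exceptional points.
    Outside a sparse set \<open>F\<close> is analytic, and there its value is its limit 0.\<close>
  have "eventually (\<lambda>z. F z = 0) (cosparse UNIV)"
    using meromorphic_on_imp_analytic_cosparse[OF F_mero]
  proof (rule eventually_mono)
    fix z assume "F analytic_on {z}"
    hence "(F \<longlongrightarrow> F z) (at z)"
      by (simp add: analytic_at_imp_isCont isContD)
    from LIM_unique[OF this c(1)] show "F z = 0"
      by (simp add: \<open>c = 0\<close>)
  qed
  thus ?thesis
    unfolding meromorphic_eq_def using mero by (simp add: F_eq)
qed

end

subsection \<open>Zeros of the theta functions\<close>

lemma ephase_of_nat_tau: "(nome \<tau> ^ 2) ^ n = ephase (of_nat n * \<tau>)"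
  unfolding ephase_tau[symmetric] ephase_power unfolding ephase_def by (simp add: mult_ac)

text \<open>Up to a factor independent of z, this is the product side of the triple product identity
  for \<open>theta1\<close>. The \<open>euler_fun\<close> factors stand for the products of 1 - x^k
  w and of 1 - x^(k+1)/w over k >= 0, where x is the squared nome and w the phase.\<close>

definition theta_product :: "complex \<Rightarrow> complex \<Rightarrow> complex" where
  "theta_product \<tau> z = exp (- (of_real pi * \<i> * z)) * euler_fun (nome \<tau> ^ 2) (ephase z)
     * euler_fun (nome \<tau> ^ 2) (nome \<tau> ^ 2 * inverse (ephase z))"

context
  fixes \<tau> :: complex
  assumes Im_pos: "Im \<tau> > 0"
begin

lemma norm_nome_square: "norm (nome \<tau> ^ 2) < 1"
  using norm_nome_less_1[OF Im_pos] by (simp add: norm_power power_less_one_iff)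

lemma euler_fun_lattice:
  assumes "euler_fun (nome \<tau> ^ 2) (ephase z) = 0"
  shows "z \<in> period_lattice \<tau>"
proof -
  from euler_fun_zeroD[OF norm_nome_square assms] obtain n where "ephase (of_nat n * \<tau>) * ephase z = 1"
    by (auto simp: ephase_of_nat_tau)
  hence "ephase z = ephase (of_int (- int n) * \<tau>)"
    by (simp add: ephase_minus field_simps)
  then obtain l :: int where "z = of_int (- int n) * \<tau> + of_int l"
    unfolding ephase_eq_iff by blast
  thus ?thesis by (metis period_latticeI)
qed

text \<open>The second Euler factor is evaluated at the phase of \<open>\<tau> - z\<close>, so a
  zero of either factor puts \<open>z\<close> into the lattice.\<close>

lemma theta_product_nonzero:
  assumes "z \<notin> period_lattice \<tau>"
  shows "theta_product \<tau> z \<noteq> 0"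
proof
  assume "theta_product \<tau> z = 0"
  moreover have "nome \<tau> ^ 2 * inverse (ephase z) = ephase (\<tau> + - z)"
    by (simp only: ephase_add ephase_minus ephase_tau[of \<tau>])
  ultimately have "z \<in> period_lattice \<tau> \<or> \<tau> + - z \<in> period_lattice \<tau>"
    using euler_fun_lattice by (auto simp: theta_product_def)
  moreover have "\<tau> \<in> period_lattice \<tau>"
    using period_latticeI[of 1 \<tau> 0] by simp
  ultimately show False
    using assms period_lattice_add_iff[of \<tau> \<tau> "- z"] by (simp add: add.commute)
qed

lemma holomorphic_theta_product: "theta_product \<tau> holomorphic_on UNIV"
proof -
  have "(euler_fun (nome \<tau> ^ 2) \<circ> g) holomorphic_on UNIV" if "g holomorphic_on UNIV" for g
    by (rule holomorphic_on_compose[OF that])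
       (rule holomorphic_on_subset[OF holomorphic_euler_fun[OF norm_nome_square]], simp)
  from this[of ephase] this[of "\<lambda>z. nome \<tau> ^ 2 * inverse (ephase z)"] show ?thesis
    unfolding theta_product_def[abs_def] o_def
    by (intro holomorphic_intros) (simp_all add: holomorphic_ephase holomorphic_on_inverse holomorphic_on_mult)
qed

lemma theta_product_plus1: "theta_product \<tau> (z + 1) = - theta_product \<tau> z"
proof -
  have "exp (- (of_real pi * \<i> * (z + 1))) = - exp (- (of_real pi * \<i> * z))"
    by (simp add: ring_distribs exp_add exp_diff exp_minus)
  thus ?thesis by (simp add: theta_product_def ephase_add)
qed

text \<open>Translation by \<open>\<tau>\<close> removes the factor 1 - w from one Euler product and
  adds 1 - 1/w to the other. Their quotient and the exponential combine to the multiplier of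
  \<open>theta1\<close>.\<close>

lemma theta_product_plus_tau:
  "theta_product \<tau> (z + \<tau>) = - inverse (nome \<tau> * ephase z) * theta_product \<tau> z"
proof -
  let ?x = "nome \<tau> ^ 2" and ?w = "ephase z"
  let ?A = "euler_fun ?x"
  have w: "ephase (z + \<tau>) = ?x * ?w"
    by (simp add: ephase_add ephase_tau[of \<tau>])
  have xw: "?x * inverse (?x * ?w) = inverse ?w"
    by (simp add: field_simps)
  have e: "exp (- (of_real pi * \<i> * (z + \<tau>))) = inverse (nome \<tau>) * exp (- (of_real pi * \<i> * z))"
    by (simp add: nome_def exp_minus[symmetric] exp_add[symmetric] algebra_simps)
  have 1: "?A ?w = (1 - ?w) * ?A (?x * ?w)"
    by (rule euler_fun_shift[OF norm_nome_square])
  have 2: "?A (inverse ?w) = (1 - inverse ?w) * ?A (?x * inverse ?w)"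
    by (rule euler_fun_shift[OF norm_nome_square])
  show ?thesis
    unfolding theta_product_def w xw e 1 2 by (simp add: field_simps)
qed

text \<open>The multiplier \<open>m\<close> may depend on z: as it never vanishes, the zero set is
  still invariant under both translations.\<close>

lemma zero_invariant_lattice:
  fixes g :: "complex \<Rightarrow> complex"
  assumes "\<And>z. g (z + 1) = - g z" "\<And>z. g (z + \<tau>) = m z * g z" "\<And>z. m z \<noteq> 0" "g 0 = 0"
    and "p \<in> period_lattice \<tau>"
  shows "g p = 0"
proof -
  obtain k l :: int where p: "p = of_int k * \<tau> + of_int l"
    using assms(5) by (rule period_latticeE)
  show ?thesis
    using int_shift_invariant[of "\<lambda>z. g z = 0" \<tau> 0 k] int_shift_invariant[of "\<lambda>z. g z = 0" 1 "of_int k * \<tau>" l]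
      assms(1-4) by (simp add: p)
qed

lemma quasi_factor_nonzero: "- inverse (nome \<tau> * ephase z) \<noteq> 0"
  by simp

lemma theta_product_lattice: "p \<in> period_lattice \<tau> \<Longrightarrow> theta_product \<tau> p = 0"
  by (rule zero_invariant_lattice[where m = "\<lambda>z. - inverse (nome \<tau> * ephase z)",
        OF theta_product_plus1 theta_product_plus_tau quasi_factor_nonzero])
     (use euler_fun_shift[OF norm_nome_square, of 1] in \<open>simp_all add: theta_product_def\<close>)

lemma theta1_lattice: "p \<in> period_lattice \<tau> \<Longrightarrow> theta1 p \<tau> = 0"
  by (rule zero_invariant_lattice[where g = "\<lambda>z. theta1 z \<tau>" and m = "\<lambda>z. - inverse (nome \<tau> * ephase z)",
        OF theta1_plus1[OF Im_pos] theta1_plus_tau[OF Im_pos] quasi_factor_nonzero])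
     (simp_all add: theta1_def)

text \<open>Splitting off the factor 1 - e^(2 pi i z) leaves a cofactor that is nonzero at 0, so the
  zero there is simple.\<close>

lemma theta_product_deriv_0: "deriv (theta_product \<tau>) 0 \<noteq> 0"
proof -
  let ?x = "nome \<tau> ^ 2"
  define R where "R z = exp (- (of_real pi * \<i> * z)) * euler_fun ?x (?x * ephase z)
     * euler_fun ?x (?x * inverse (ephase z))" for z
  have "(euler_fun ?x \<circ> g) holomorphic_on UNIV" if "g holomorphic_on UNIV" for g
    by (rule holomorphic_on_compose[OF that])
       (rule holomorphic_on_subset[OF holomorphic_euler_fun[OF norm_nome_square]], simp)
  from this[of "\<lambda>z. ?x * ephase z"] this[of "\<lambda>z. ?x * inverse (ephase z)"] have "R holomorphic_on UNIV"
    unfolding R_def[abs_def] o_def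
    by (intro holomorphic_intros) (simp_all add: holomorphic_ephase holomorphic_on_inverse holomorphic_on_mult)
  hence R: "(R has_field_derivative deriv R 0) (at 0)"
    by (rule holomorphic_derivI) auto
  have "theta_product \<tau> z = (1 - ephase z) * R z" for z
    unfolding theta_product_def R_def euler_fun_shift[OF norm_nome_square, of "ephase z"] by (simp only: mult_ac)
  hence "theta_product \<tau> = (\<lambda>z. (1 - ephase z) * R z)" ..
  moreover have "((\<lambda>z. (1 - ephase z) * R z) has_field_derivative - (2 * of_real pi * \<i>) * R 0) (at 0)"
    unfolding ephase_def by (rule derivative_eq_intros R refl)+ simp
  ultimately have "deriv (theta_product \<tau>) 0 = - (2 * of_real pi * \<i>) * R 0"
    by (simp add: DERIV_imp_deriv)
  moreover have "euler_fun ?x ?x \<noteq> 0"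
  proof
    assume "euler_fun ?x ?x = 0"
    from euler_fun_zeroD[OF norm_nome_square this] obtain n where "?x ^ Suc n = 1"
      by (auto simp: mult.commute)
    moreover have "norm (?x ^ Suc n) < 1"
      using norm_nome_square unfolding norm_power[of _ "Suc n"] by (subst power_less_one_iff) auto
    ultimately show False by simp
  qed
  ultimately show ?thesis by (simp add: R_def)
qed

text \<open>Both functions have the same multipliers, so their quotient is elliptic. It has no
  poles, because the zeros of the product are simple and \<open>theta1\<close> vanishes at them;
  Liouville makes it constant.\<close>

lemma theta1_eq_theta_product: "\<exists>c. c \<noteq> 0 \<and> (\<forall>z. theta1 z \<tau> = c * theta_product \<tau> z)"
proof -
  let ?P = "theta_product \<tau>"
  define h where "h z = theta1 z \<tau> / ?P z" for z
  have an: "(\<lambda>z. theta1 z \<tau>) analytic_on A" "?P analytic_on A" for A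
    using holomorphic_theta1[OF Im_pos] holomorphic_theta_product analytic_on_open analytic_on_subset by blast+
  have mero: "h meromorphic_on UNIV"
    unfolding h_def[abs_def] by (intro meromorphic_intros analytic_on_imp_meromorphic_on an)
  have per: "h (z + 1) = 1 * h z" "h (z + \<tau>) = 1 * h z" for z
    unfolding h_def theta1_plus1[OF Im_pos] theta_product_plus1 theta1_plus_tau[OF Im_pos] theta_product_plus_tau
    using quasi_factor_nonzero[of z] by simp_all
  have lim0: "finite_limit h 0"
  proof -
    have d: "((\<lambda>z. theta1 z \<tau> / z) \<longlongrightarrow> deriv (\<lambda>z. theta1 z \<tau>) 0) (at 0)" "((\<lambda>z. ?P z / z) \<longlongrightarrow> deriv ?P 0) (at 0)"
      using holomorphic_derivI[OF holomorphic_theta1[OF Im_pos], of 0] holomorphic_derivI[OF holomorphic_theta_product, of 0]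
        theta1_lattice[of 0] theta_product_lattice[of 0]
      by (simp_all add: has_field_derivative_iff)
    \<comment> \<open>Dividing numerator and denominator by z turns both into difference quotients
      at their common zero.\<close>
    have "((\<lambda>z. (theta1 z \<tau> / z) / (?P z / z)) \<longlongrightarrow> deriv (\<lambda>z. theta1 z \<tau>) 0 / deriv ?P 0) (at 0)"
      by (intro tendsto_divide d theta_product_deriv_0)
    hence lim: "finite_limit (\<lambda>z. (theta1 z \<tau> / z) / (?P z / z)) 0"
      by (rule finite_limitI)
    have ev: "eventually (\<lambda>z. (theta1 z \<tau> / z) / (?P z / z) = h z) (at 0)"
      by (auto simp: eventually_at_filter h_def)
    show ?thesis
      using lim unfolding finite_limit_cong[OF ev] .
  qed
  have lim: "finite_limit h p" for p
  proof (cases "p \<in> period_lattice \<tau>")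
    case True
    show ?thesis
      by (rule finite_limit_lattice[OF _ _ per lim0 True]) simp_all
  next
    case False
    show ?thesis
      unfolding h_def[abs_def]
      by (intro finite_limit_analytic analytic_on_divide an) (use theta_product_nonzero[OF False] in auto)
  qed
  obtain c where c: "\<And>p. (h \<longlongrightarrow> c) (at p)"
    using liouville_quasi_periodic[OF Im_pos mero _ _ per lim] by auto
  have eq: "theta1 z \<tau> = c * ?P z" for z
  proof (cases "z \<in> period_lattice \<tau>")
    case False
    have "h analytic_on {z}"
      unfolding h_def[abs_def] by (intro analytic_on_divide an) (use theta_product_nonzero[OF False] in auto)
    hence "(h \<longlongrightarrow> h z) (at z)"
      by (simp add: analytic_at_imp_isCont isContD)
    hence "h z = c" using c LIM_unique by blast
    thus ?thesis using theta_product_nonzero[OF False] by (auto simp: h_def)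
  qed (simp add: theta1_lattice theta_product_lattice)
  \<comment> \<open>Up to an exponential factor \<open>theta1\<close> is a translate of
    \<open>theta3\<close>, so it is not identically 0 and neither is the constant.\<close>
  obtain z where "theta3 z \<tau> \<noteq> 0"
    using theta3_not_identically_0[OF Im_pos] by blast
  hence "theta1 (z - \<tau> / 2 + 1/2) \<tau> \<noteq> 0"
    by (simp add: theta1_eq_theta2 theta2_eq_theta3[OF Im_pos])
  hence "c \<noteq> 0" using eq by auto
  thus ?thesis using eq by blast
qed

lemma theta1_eq_0_iff: "theta1 z \<tau> = 0 \<longleftrightarrow> z \<in> period_lattice \<tau>"
proof (cases "z \<in> period_lattice \<tau>")
  case False
  thus ?thesis using theta1_eq_theta_product theta_product_nonzero[of z] by auto
qed (simp add: theta1_lattice)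

lemma theta1_deriv_0: "deriv (\<lambda>z. theta1 z \<tau>) 0 \<noteq> 0"
proof -
  obtain c where c: "c \<noteq> 0" "\<And>z. theta1 z \<tau> = c * theta_product \<tau> z"
    using theta1_eq_theta_product by blast
  have "theta_product \<tau> field_differentiable at 0"
    using holomorphic_theta_product by (auto simp: holomorphic_on_def)
  thus ?thesis
    using c theta_product_deriv_0 by (simp add: deriv_cmult)
qed

text \<open>Up to an exponential factor, \<open>theta4\<close> at z is \<open>theta1\<close> at z +
  1 - tau/2, and this point differs from z + tau/2 by a period.\<close>

lemma theta4_eq_0_iff: "theta4 z \<tau> = 0 \<longleftrightarrow> z + \<tau> / 2 \<in> period_lattice \<tau>"
proof -
  have "theta1 (z + 1 - \<tau> / 2) \<tau> = 0 \<longleftrightarrow> theta3 (z + 1/2) \<tau> = 0"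
    by (simp add: theta1_eq_theta2 theta2_eq_theta3[OF Im_pos] add.commute)
  moreover have "z + 1 - \<tau> / 2 = z + \<tau> / 2 + (of_int (-1) * \<tau> + of_int 1)"
    by simp
  ultimately show ?thesis
    by (simp only: theta4_eq_theta3[symmetric] theta1_eq_0_iff period_lattice_add_iff[OF period_latticeI])
qed

lemma theta2_eq_0_iff: "theta2 z \<tau> = 0 \<longleftrightarrow> z + 1/2 \<in> period_lattice \<tau>"
  using theta1_eq_0_iff[of "z + 1/2"] by (simp add: theta1_eq_theta2)

lemma theta3_eq_0_iff: "theta3 z \<tau> = 0 \<longleftrightarrow> z + (1 + \<tau>) / 2 \<in> period_lattice \<tau>"
proof -
  have "theta4 (z - 1/2) \<tau> = theta3 z \<tau>"
    by (simp add: theta4_eq_theta3)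
  moreover have "z + (1 + \<tau>) / 2 = z - 1/2 + \<tau> / 2 + (of_int 0 * \<tau> + of_int 1)"
    by (simp add: field_simps)
  ultimately show ?thesis
    using theta4_eq_0_iff[of "z - 1/2"] by (simp only: period_lattice_add_iff[OF period_latticeI])
qed

text \<open>By uniqueness of real coordinates, x/2 and y/2 would both be integers. For the three
  nonzero half-periods this shows that \<open>theta2\<close>, \<open>theta3\<close> and
  \<open>theta4\<close> do not vanish at lattice points.\<close>

lemma half_period_notin_lattice:
  fixes x y :: int
  assumes "odd x \<or> odd y"
  shows "(of_int x * \<tau> + of_int y) / 2 \<notin> period_lattice \<tau>"
proof
  assume "(of_int x * \<tau> + of_int y) / 2 \<in> period_lattice \<tau>"
  then obtain k l :: int where "(of_int x * \<tau> + of_int y) / 2 = of_int k * \<tau> + of_int l"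
    by (rule period_latticeE)
  hence "of_real (of_int x) * \<tau> + of_real (of_int y) = of_real (of_int (2 * k)) * \<tau> + of_real (of_int (2 * l))"
    by (simp add: field_simps)
  from lattice_coords_unique[OF Im_pos this] have "x = 2 * k" "y = 2 * l"
    by (simp_all only: of_int_eq_iff)
  thus False using assms by auto
qed

lemma theta_lattice_nonzero:
  assumes "p \<in> period_lattice \<tau>"
  shows "theta2 p \<tau> \<noteq> 0" "theta3 p \<tau> \<noteq> 0" "theta4 p \<tau> \<noteq> 0"
  using half_period_notin_lattice[of 0 1] half_period_notin_lattice[of 1 1] half_period_notin_lattice[of 1 0]
    period_lattice_add_iff[OF assms]
  by (simp_all add: theta2_eq_0_iff theta3_eq_0_iff theta4_eq_0_iff add.commute[of p] add.commute[of 1 \<tau>])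

end

section \<open>From theta quotients to the functions f\<close>

text \<open>Multiplying by z turns the odd quotient into an even holomorphic function g near 0. Its
  derivative vanishes at 0, so (g(z) - g(0))/z has a zero there and can be divided by z once
  more.\<close>

lemma odd_principal_quotient:
  fixes t s :: "complex \<Rightarrow> complex"
  assumes t: "t holomorphic_on UNIV" "\<And>z. t (- z) = t z"
    and s: "s holomorphic_on UNIV" "\<And>z. s (- z) = - s z" "deriv s 0 \<noteq> 0"
  shows "odd_principal (t 0 / deriv s 0) (\<lambda>z. t z / s z)"
proof -
  have s0: "s 0 = 0" using s(2)[of 0] by simp
  \<comment> \<open>This is \<open>s\<close> with its simple zero at 0 divided out; it is entire and
    nonzero at 0.\<close>
  define u where "u z = (if z = 0 then deriv s 0 else s z / z)" for z
  have u_hol: "u holomorphic_on UNIV"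
  proof -
    have "u = (\<lambda>z. if z = 0 then deriv s 0 else (s z - s 0) / (z - 0))"
      by (simp add: fun_eq_iff u_def s0)
    thus ?thesis
      using pole_lemma_open[OF s(1) open_UNIV, of 0] by (simp only:)
  qed
  define S where "S = {z. u z \<noteq> 0}"
  have "open S"
    unfolding S_def
    by (intro open_Collect_neq holomorphic_on_imp_continuous_on[OF u_hol] continuous_on_const)
  have "0 \<in> S" using s(3) by (simp add: S_def u_def)
  define g where "g z = t z / u z" for z
  have g_hol: "g holomorphic_on S"
    unfolding g_def[abs_def]
    by (intro holomorphic_intros holomorphic_on_subset[OF t(1)] holomorphic_on_subset[OF u_hol]) (auto simp: S_def)
  have g_even: "g (- z) = g z" for z
    by (simp add: g_def u_def t(2) s(2))
  have dg: "(g has_field_derivative deriv g 0) (at 0)"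
    by (rule holomorphic_derivI[OF g_hol \<open>open S\<close> \<open>0 \<in> S\<close>])
  have "deriv g 0 = 0"
  proof -
    have "((\<lambda>z. g (- z)) has_field_derivative deriv g 0 * (-1)) (at 0)"
      by (rule DERIV_chain2[where f = g]) (auto intro!: derivative_eq_intros simp: dg)
    hence "(g has_field_derivative - deriv g 0) (at 0)"
      by (simp add: g_even)
    from DERIV_unique[OF dg this] show ?thesis by simp
  qed
  define k where "k z = (if z = 0 then deriv g 0 else (g z - g 0) / (z - 0))" for z
  have "k holomorphic_on S"
    unfolding k_def[abs_def] by (rule pole_lemma_open[OF g_hol \<open>open S\<close>])
  hence "(k has_field_derivative deriv k 0) (at 0)"
    by (rule holomorphic_derivI[OF _ \<open>open S\<close> \<open>0 \<in> S\<close>])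
  moreover have "k 0 = 0"
    by (simp add: k_def \<open>deriv g 0 = 0\<close>)
  ultimately have "finite_limit (\<lambda>z. k z / z) 0"
    by (auto simp: has_field_derivative_iff intro: finite_limitI)
  moreover have ev: "eventually (\<lambda>z. k z / z = (t z / s z - t 0 / deriv s 0 / z) / z) (at 0)"
    by (auto simp: eventually_at_filter k_def g_def u_def diff_divide_distrib)
  ultimately show ?thesis
    unfolding odd_principal_def finite_limit_cong[OF ev] by simp
qed

text \<open>At a zero of the denominator there is a genuine pole, where \<open>remove_sings\<close>
  returns 0. Division by zero also returns 0, so one formula covers both cases.\<close>

lemma remove_sings_quotient:
  fixes n d :: "complex \<Rightarrow> complex"
  assumes "n analytic_on {u}" "d analytic_on {u}"
    and ev: "eventually (\<lambda>w. g w = n w / d w) (at u)" and nz: "eventually (\<lambda>w. d w \<noteq> 0) (at u)"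
    and "n u \<noteq> 0 \<or> d u \<noteq> 0"
  shows "remove_sings g u = n u / d u"
proof (cases "d u = 0")
  case False
  hence "(\<lambda>w. n w / d w) analytic_on {u}"
    using assms by (intro analytic_on_divide) auto
  thus ?thesis
    using remove_sings_cong[OF ev refl] by simp
next
  case True
  have "filterlim d (at 0) (at u)"
    unfolding filterlim_at using nz True analytic_at_imp_isCont[OF assms(2)] by (simp add: isCont_def)
  hence "is_pole (\<lambda>w. n w / d w) u"
    using True assms(1,5) by (intro is_pole_divide analytic_at_imp_isCont) auto
  thus ?thesis
    using remove_sings_cong[OF ev refl] True by simp
qed

context
  fixes \<tau> :: complex
  assumes Im_pos: "Im \<tau> > 0"
begin

lemma jacobi_K_nonzero: "jacobi_K \<tau> \<noteq> 0"
  using theta_lattice_nonzero(2)[OF Im_pos period_lattice_0] by (simp add: jacobi_K_def)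

lemma holomorphic_nonzero_near:
  assumes "g holomorphic_on UNIV" "g p \<noteq> 0"
  shows "eventually (\<lambda>w. g (w / (2 * jacobi_K \<tau>)) \<noteq> 0) (at u)"
proof -
  let ?k = "2 * jacobi_K \<tau>"
  have "(\<lambda>w. g (w / ?k)) holomorphic_on UNIV"
    using holomorphic_on_compose[OF _ holomorphic_on_subset[OF assms(1)], of "\<lambda>w. w / ?k" UNIV] jacobi_K_nonzero
    by (simp add: o_def holomorphic_intros)
  from non_zero_neighbour_alt[OF this, of u "?k * p"] show ?thesis
    using assms(2) jacobi_K_nonzero by (simp add: connected_UNIV)
qed

text \<open>The pointwise quotients are correct off the zeros of \<open>theta4\<close>, which are
  isolated. Since \<open>t\<close> and \<open>theta1\<close> have no common zero, the cancelled
  quotient already gives the right values everywhere.\<close>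

lemma remove_sings_theta_quotient:
  assumes t: "t holomorphic_on UNIV" "\<And>p. p \<in> period_lattice \<tau> \<Longrightarrow> t p \<noteq> 0"
    and g: "\<And>w. theta4 (w / (2 * jacobi_K \<tau>)) \<tau> \<noteq> 0 \<Longrightarrow>
        g w = C * t (w / (2 * jacobi_K \<tau>)) / theta1 (w / (2 * jacobi_K \<tau>)) \<tau>"
  shows "remove_sings g (2 * jacobi_K \<tau> * z) = C * t z / theta1 z \<tau>"
proof (cases "C = 0")
  \<comment> \<open>For \<open>C = 0\<close> the numerator would vanish together with
    \<open>theta1\<close> at lattice points, so \<open>remove_sings_quotient\<close> does not apply
    and the limit 0 is taken directly.\<close>
  case True
  have "eventually (\<lambda>w. g w = 0) (at (2 * jacobi_K \<tau> * z))"
    using holomorphic_nonzero_near[OF holomorphic_theta4[OF Im_pos] theta_lattice_nonzero(3)[OF Im_pos period_lattice_0]]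
    by eventually_elim (simp add: g True)
  from remove_sings_cong[OF this refl] show ?thesis by (simp add: True)
next
  case False
  let ?k = "2 * jacobi_K \<tau>"
  have k: "?k \<noteq> 0" using jacobi_K_nonzero by simp
  have an: "(\<lambda>w. h (w / ?k)) analytic_on A" if "h holomorphic_on UNIV" for h A
  proof -
    have "(\<lambda>w. h (w / ?k)) holomorphic_on UNIV"
      using holomorphic_on_compose[OF _ holomorphic_on_subset[OF that], of "\<lambda>w. w / ?k" UNIV] k
      by (simp add: o_def holomorphic_intros)
    thus ?thesis using analytic_on_open analytic_on_subset by blast
  qed
  \<comment> \<open>This is a witness that \<open>theta1\<close> is not identically 0, from which
    its zeros are isolated.\<close>
  have "theta1 (1/2) \<tau> \<noteq> 0"
    using half_period_notin_lattice[OF Im_pos, of 0 1] by (simp add: theta1_eq_0_iff[OF Im_pos])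
  have "remove_sings g (?k * z) = C * t (?k * z / ?k) / theta1 (?k * z / ?k) \<tau>"
  proof (rule remove_sings_quotient)
    show "eventually (\<lambda>w. g w = C * t (w / ?k) / theta1 (w / ?k) \<tau>) (at (?k * z))"
      using holomorphic_nonzero_near[OF holomorphic_theta4[OF Im_pos] theta_lattice_nonzero(3)[OF Im_pos period_lattice_0]]
      by eventually_elim (rule g)
    show "eventually (\<lambda>w. theta1 (w / ?k) \<tau> \<noteq> 0) (at (?k * z))"
      by (rule holomorphic_nonzero_near[OF holomorphic_theta1[OF Im_pos]]) fact
    show "(\<lambda>w. C * t (w / ?k)) analytic_on {?k * z}" "(\<lambda>w. theta1 (w / ?k) \<tau>) analytic_on {?k * z}"
      by (intro analytic_intros an t holomorphic_theta1[OF Im_pos])+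
    show "C * t (?k * z / ?k) \<noteq> 0 \<or> theta1 (?k * z / ?k) \<tau> \<noteq> 0"
      using t(2)[of z] k False by (auto simp: theta1_eq_0_iff[OF Im_pos])
  qed
  thus ?thesis using k by simp
qed

definition theta_index :: "nat \<Rightarrow> nat \<Rightarrow> complex \<Rightarrow> complex" where
  "theta_index r s z = (if even s then theta2 z \<tau> else if odd r then theta3 z \<tau> else theta4 z \<tau>)"

text \<open>The constant is written with \<open>theta_index r s 0\<close> in the denominator, so
  that normalising the numerator to 1 at 0 leaves a factor common to all three functions.\<close>

lemma ell_f_eq_theta_quotient:
  assumes "odd r \<or> odd s"
  shows "ell_f r s z \<tau> = 2 * jacobi_K \<tau> * theta2 0 \<tau> * theta4 0 \<tau> / (theta3 0 \<tau> * theta_index r s 0)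
           * (theta_index r s z / theta1 z \<tau>)"
proof -
  note nz = theta_lattice_nonzero[OF Im_pos]
  note nz0 = nz[OF period_lattice_0]
  have cs: "jacobi_cs (2 * jacobi_K \<tau> * z) \<tau> = theta4 0 \<tau> / theta3 0 \<tau> * theta2 z \<tau> / theta1 z \<tau>"
    unfolding jacobi_cs_def
    by (rule remove_sings_theta_quotient[OF holomorphic_theta2[OF Im_pos] nz(1)])
       (use nz0 in \<open>simp_all add: jacobi_cn_def jacobi_sn_def Let_def divide_simps\<close>)
  have ds: "jacobi_ds (2 * jacobi_K \<tau> * z) \<tau> = theta4 0 \<tau> * theta2 0 \<tau> / theta3 0 \<tau> ^ 2 * theta3 z \<tau> / theta1 z \<tau>"
    unfolding jacobi_ds_def
    by (rule remove_sings_theta_quotient[OF holomorphic_theta3[OF Im_pos] nz(2)])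
       (use nz0 in \<open>simp_all add: jacobi_dn_def jacobi_sn_def Let_def divide_simps power2_eq_square\<close>)
  have ns: "jacobi_ns (2 * jacobi_K \<tau> * z) \<tau> = theta2 0 \<tau> / theta3 0 \<tau> * theta4 z \<tau> / theta1 z \<tau>"
    unfolding jacobi_ns_def
    by (rule remove_sings_theta_quotient[OF holomorphic_theta4[OF Im_pos] nz(3)])
       (use nz0 in \<open>simp_all add: jacobi_sn_def Let_def divide_simps\<close>)
  show ?thesis
    using assms nz0 unfolding ell_f_def cs ds ns theta_index_def
    by (auto simp: power2_eq_square)
qed

text \<open>The displayed constant is the common residue at 0: the value of the numerator theta
  function at 0 cancels against the normalisation, so no dependence on \<open>r\<close>,
  \<open>s\<close> is left.\<close>

lemma ell_system_ell_f:
  "ell_system \<tau> (2 * jacobi_K \<tau> * theta2 0 \<tau> * theta4 0 \<tau> / (theta3 0 \<tau> * deriv (\<lambda>z. theta1 z \<tau>) 0))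
     (\<lambda>r s z. ell_f r s z \<tau>)"
proof
  fix r s :: nat
  assume rs: "odd r \<or> odd s"
  define C where "C = 2 * jacobi_K \<tau> * theta2 0 \<tau> * theta4 0 \<tau> / (theta3 0 \<tau> * theta_index r s 0)"
  define t where "t = theta_index r s"
  have f: "ell_f r s z \<tau> = C * (t z / theta1 z \<tau>)" for z
    unfolding C_def t_def by (rule ell_f_eq_theta_quotient[OF rs])
  have t_hol: "t holomorphic_on UNIV"
    unfolding t_def theta_index_def[abs_def]
    using holomorphic_theta2[OF Im_pos] holomorphic_theta3[OF Im_pos] holomorphic_theta4[OF Im_pos]
    by (cases "even s"; cases "even r") simp_all
  have t_even: "t (- z) = t z" for z
    by (simp add: t_def theta_index_def theta2_minus theta3_minus theta4_minus)
  have t0: "t 0 \<noteq> 0"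
    using theta_lattice_nonzero[OF Im_pos period_lattice_0] by (simp add: t_def theta_index_def)
  have an: "t analytic_on A" "(\<lambda>z. theta1 z \<tau>) analytic_on A" for A
    using t_hol holomorphic_theta1[OF Im_pos] analytic_on_open analytic_on_subset by blast+
  show "ell_f r s (- z) \<tau> = - ell_f r s z \<tau>" for z
    by (simp add: f t_even theta1_minus[OF Im_pos])
  show "ell_f r s (z + 1) \<tau> = (-1) ^ s * ell_f r s z \<tau>" for z
    unfolding f by (auto simp: t_def theta_index_def theta1_plus1[OF Im_pos] theta2_plus1[OF Im_pos]
        theta3_plus1[OF Im_pos] theta4_plus1[OF Im_pos])
  show "ell_f r s (z + \<tau>) \<tau> = (-1) ^ r * ell_f r s z \<tau>" for z
    using rs unfolding f by (auto simp: t_def theta_index_def theta1_plus_tau[OF Im_pos] theta2_plus_tau[OF Im_pos]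
        theta3_plus_tau[OF Im_pos] theta4_plus_tau[OF Im_pos])
  show "(\<lambda>z. ell_f r s z \<tau>) analytic_on {z}" if "z \<notin> period_lattice \<tau>" for z
    unfolding f using that by (intro analytic_intros an) (auto simp: theta1_eq_0_iff[OF Im_pos])
  show "(\<lambda>z. ell_f r s z \<tau>) meromorphic_on UNIV"
    unfolding f by (intro meromorphic_intros analytic_on_imp_meromorphic_on an)
  have "finite_limit (\<lambda>z. C * ((t z / theta1 z \<tau> - t 0 / deriv (\<lambda>z. theta1 z \<tau>) 0 / z) / z)) 0"
    using odd_principal_quotient[OF t_hol t_even holomorphic_theta1[OF Im_pos] theta1_minus[OF Im_pos] theta1_deriv_0[OF Im_pos]]
    by (intro finite_limit_mult finite_limit_const) (simp add: odd_principal_def)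
  moreover have c: "2 * jacobi_K \<tau> * theta2 0 \<tau> * theta4 0 \<tau> / (theta3 0 \<tau> * deriv (\<lambda>z. theta1 z \<tau>) 0)
      = C * (t 0 / deriv (\<lambda>z. theta1 z \<tau>) 0)"
    using t0 by (simp add: C_def t_def)
  ultimately show "odd_principal (2 * jacobi_K \<tau> * theta2 0 \<tau> * theta4 0 \<tau> / (theta3 0 \<tau> * deriv (\<lambda>z. theta1 z \<tau>) 0))
      (\<lambda>z. ell_f r s z \<tau>)"
    unfolding odd_principal_def f c by (simp add: right_diff_distrib)
qed (rule Im_pos)

end

theorem theorem3:
  fixes a b i j m n :: nat and \<tau> :: complex
  assumes "a > 0" and "b > 0" and "coprime a b"
    and "i \<in> {0, 1}" and "j \<in> {0, 1}" and "m \<in> {0, 1}" and "n \<in> {0, 1}"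
    and "(i, j) \<noteq> (0, 0)" and "(m, n) \<noteq> (0, 0)"
    and "\<tau> \<in> fund_domain_Gamma2"
    and "odd (i * a + m * b) \<or> odd (j * a + n * b)"
  shows "meromorphic_eq
    (\<lambda>z. 1 / of_nat a *
           (\<Sum>(\<mu>, \<nu>) \<in> {0..<a} \<times> {0..<a} - {(0, 0)}.
              (-1) ^ (i * \<mu> + j * \<nu>)
              * ell_f m n (of_nat b * ((of_nat \<mu> * \<tau> + of_nat \<nu>) / of_nat a)) \<tau>
              * ell_f (i * a + m * b) (j * a + n * b) (z + (of_nat \<mu> * \<tau> + of_nat \<nu>) / of_nat a) \<tau>)
       + 1 / of_nat b *
           (\<Sum>(\<mu>, \<nu>) \<in> {0..<b} \<times> {0..<b} - {(0, 0)}.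
              (-1) ^ (m * \<mu> + n * \<nu>)
              * ell_f i j (of_nat a * ((of_nat \<mu> * \<tau> + of_nat \<nu>) / of_nat b)) \<tau>
              * ell_f (i * a + m * b) (j * a + n * b) (z + (of_nat \<mu> * \<tau> + of_nat \<nu>) / of_nat b) \<tau>))
    (\<lambda>z. - ell_f i j (of_nat a * z) \<tau> * ell_f m n (of_nat b * z) \<tau>
       + 1 / (of_nat a * of_nat b)
         * ell_f (i * a + m * b + 1) 1 z \<tau> * ell_f 1 (j * a + n * b + 1) z \<tau>)"
proof -
  have "Im \<tau> > 0"
    using assms(10) by (simp add: fund_domain_Gamma2_def)
  then interpret ell_system \<tau> "2 * jacobi_K \<tau> * theta2 0 \<tau> * theta4 0 \<tau> / (theta3 0 \<tau> * deriv (\<lambda>z. theta1 z \<tau>) 0)"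
    "\<lambda>r s z. ell_f r s z \<tau>"
    by (rule ell_system_ell_f)
  have "odd i \<or> odd j" "odd m \<or> odd n"
    using assms(4-9) by auto
  from torsion_identity[OF assms(1-3) this refl refl assms(11)] show ?thesis
    \<comment> \<open>With \<open>r\<close> and \<open>s\<close> instantiated by reflexivity,
      unfolding produces literally the two sums of the statement.\<close>
    unfolding torsion_sum_def torsion_point_def .
qed

end
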